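(* Every hyperbolic group is isomorphic to a subgroup of the rational group $\mathcal{R}_2$.
   Context: A hyperbolic group is a finitely generated group whose Cayley graph (with respect to some, equivalently any, finite generating set) is $\delta$-hyperbolic for some $\delta\ge 0$ in the sense of Gromov. For finite sets $A,B$, a transducer with input alphabet $A$ and output alphabet $B$ consists of a finite set $Q$ of states, an initial state $q_0\in Q$, a transition function $t\colon Q\times A\to Q$ and an output function $o\colon Q\times A\to B^*$, where $B^*$ denotes the set of finite words over $B$, including the empty word. On an input $a_1a_2\cdots\in A^\omega$ the transducer passes through the states $q_n=t(q_{n-1},a_n)$ and produces the output $o(q_0,a_1)\,o(q_1,a_2)\,o(q_2,a_3)\cdots$. The transducer is nondegenerate if this output is infinite for every input. A function $f\colon A^\omega\to B^\omega$ is rational if some nondegenerate transducer outputs $f(\psi)$ on every input $\psi$. The rational group $\mathcal{R}_2$ is the group, under composition, of all rational homeomorphisms of the Cantor set $\{0,1\}^\omega$, where $\{0,1\}^\omega$ carries the product topology. *)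

theory Defs
  imports "HOL-Analysis.Analysis" "HOL-Algebra.Algebra"
begin

definition word_len :: "('g, 'm) monoid_scheme \<Rightarrow> 'g set \<Rightarrow> 'g \<Rightarrow> nat" where
  "word_len G S g =
     (LEAST n. \<exists>ws. length ws = n \<and> set ws \<subseteq> S \<union> (\<lambda>s. inv\<^bsub>G\<^esub> s) ` S
                  \<and> foldr (\<lambda>x y. x \<otimes>\<^bsub>G\<^esub> y) ws \<one>\<^bsub>G\<^esub> = g)"

text \<open>Word metric = graph metric of the Cayley graph restricted to its vertices.\<close>
definition word_dist :: "('g, 'm) monoid_scheme \<Rightarrow> 'g set \<Rightarrow> 'g \<Rightarrow> 'g \<Rightarrow> real" where
  "word_dist G S g h = real (word_len G S (inv\<^bsub>G\<^esub> g \<otimes>\<^bsub>G\<^esub> h))"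

definition gromov_product :: "('g, 'm) monoid_scheme \<Rightarrow> 'g set \<Rightarrow> 'g \<Rightarrow> 'g \<Rightarrow> 'g \<Rightarrow> real" where
  "gromov_product G S x y w =
     (word_dist G S w x + word_dist G S w y - word_dist G S x y) / 2"

definition delta_hyperbolic_cayley :: "('g, 'm) monoid_scheme \<Rightarrow> 'g set \<Rightarrow> real \<Rightarrow> bool" where
  "delta_hyperbolic_cayley G S \<delta> \<longleftrightarrow> \<delta> \<ge> 0 \<and>
     (\<forall>x\<in>carrier G. \<forall>y\<in>carrier G. \<forall>z\<in>carrier G. \<forall>w\<in>carrier G.
        gromov_product G S x y w \<ge> min (gromov_product G S x z w) (gromov_product G S y z w) - \<delta>)"

definition hyperbolic_group :: "('g, 'm) monoid_scheme \<Rightarrow> bool" where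
  "hyperbolic_group G \<longleftrightarrow> group G \<and>
     (\<exists>S \<delta>. finite S \<and> S \<subseteq> carrier G \<and> generate G S = carrier G
            \<and> delta_hyperbolic_cayley G S \<delta>)"

fun trans_state :: "('q \<Rightarrow> 'a \<Rightarrow> 'q) \<Rightarrow> 'q \<Rightarrow> (nat \<Rightarrow> 'a) \<Rightarrow> nat \<Rightarrow> 'q" where
  "trans_state t q0 \<psi> 0 = q0"
| "trans_state t q0 \<psi> (Suc n) = t (trans_state t q0 \<psi> n) (\<psi> n)"

definition trans_out_prefix ::
  "('q \<Rightarrow> 'a \<Rightarrow> 'q) \<Rightarrow> ('q \<Rightarrow> 'a \<Rightarrow> 'b list) \<Rightarrow> 'q \<Rightarrow> (nat \<Rightarrow> 'a) \<Rightarrow> nat \<Rightarrow> 'b list" where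
  "trans_out_prefix t out q0 \<psi> n = concat (map (\<lambda>i. out (trans_state t q0 \<psi> i) (\<psi> i)) [0..<n])"

definition transducer :: "'q set \<Rightarrow> 'q \<Rightarrow> ('q \<Rightarrow> 'a \<Rightarrow> 'q) \<Rightarrow> ('q \<Rightarrow> 'a \<Rightarrow> 'b list) \<Rightarrow> bool" where
  "transducer Q q0 t out \<longleftrightarrow> finite Q \<and> q0 \<in> Q \<and> (\<forall>q\<in>Q. \<forall>a. t q a \<in> Q)"

definition nondegenerate :: "('q \<Rightarrow> 'a \<Rightarrow> 'q) \<Rightarrow> ('q \<Rightarrow> 'a \<Rightarrow> 'b list) \<Rightarrow> 'q \<Rightarrow> bool" where
  "nondegenerate t out q0 \<longleftrightarrow>
     (\<forall>\<psi> k. \<exists>n. length (trans_out_prefix t out q0 \<psi> n) > k)"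

definition outputs :: "('q \<Rightarrow> 'a \<Rightarrow> 'q) \<Rightarrow> ('q \<Rightarrow> 'a \<Rightarrow> 'b list) \<Rightarrow> 'q \<Rightarrow> (nat \<Rightarrow> 'a) \<Rightarrow> (nat \<Rightarrow> 'b) \<Rightarrow> bool" where
  "outputs t out q0 \<psi> \<phi> \<longleftrightarrow>
     (\<forall>n k. k < length (trans_out_prefix t out q0 \<psi> n) \<longrightarrow> trans_out_prefix t out q0 \<psi> n ! k = \<phi> k)"

text \<open>Rational function A^\<omega> \<rightarrow> B^\<omega> (finite alphabets are the types 'a, 'b; states coded in nat,
  which loses nothing since the state set is finite).\<close>
definition rational_fun :: "((nat \<Rightarrow> 'a) \<Rightarrow> (nat \<Rightarrow> 'b)) \<Rightarrow> bool" where
  "rational_fun f \<longleftrightarrow>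
     (\<exists>(Q::nat set) q0 t out. transducer Q q0 t out \<and> nondegenerate t out q0
        \<and> (\<forall>\<psi>. outputs t out q0 \<psi> (f \<psi>)))"

definition cantor_top :: "(nat \<Rightarrow> bool) topology" where
  "cantor_top = product_topology (\<lambda>_. discrete_topology (UNIV :: bool set)) UNIV"

definition R2 :: "((nat \<Rightarrow> bool) \<Rightarrow> (nat \<Rightarrow> bool)) monoid" where
  "R2 = \<lparr> carrier = {f. rational_fun f \<and> homeomorphic_map cantor_top cantor_top f},
          mult = (\<lambda>f g. f \<circ> g), one = id \<rparr>"

end

theory Submission
  imports Defs
begin

text \<open>For \<open>y\<close> in the group, follow a geodesic from \<open>1\<close> to \<open>y\<close> chosen by a rule that only looks at the
  restriction of the horofunction \<open>d(y, \<cdot>)\<close> to a ball of fixed radius around the current point, and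
  record these restrictions. Attaching a Cantor set to every \<open>y\<close>, read off once \<open>y\<close> is reached, gives
  a set of itineraries without isolated points. By hyperbolicity the translated follower set of a
  finite itinerary is determined by a horofunction on a slightly larger ball, so there are finitely
  many types; and left translation by \<open>g\<close> maps the cone of a finite itinerary into the cone of one
  that is shorter by at most a constant, the base points differing by one of finitely many group
  elements. Coding the possible next letters of each type by a complete prefix code turns the
  itineraries into a dense subset of \<open>{0,1}\<^sup>\<omega>\<close>, on which each \<open>g\<close> has finitely many local actions, so
  a transducer emitting longest common prefixes extends it to a rational homeomorphism. The action
  is faithful because translation is free on the group itself.\<close>

section \<open>Prefixes of sequences\<close>

text \<open>The boundary of a hyperbolic group is not a suitable space for a uniform argument: it is
  empty for finite groups, may have two points, and its action may have a finite kernel. Taking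
  group elements themselves as endpoints and hanging a Cantor set on each removes these cases at
  once. The price, for an infinite group, is that limits of itineraries along longer and longer
  geodesics are not itineraries of points of \<open>Om\<close>. Hence nothing rests on compactness
  of \<open>Om\<close>: a map on a dense set of codes with finitely many local actions is enough for
  the transducer. The geometric core is \<open>sig_extend\<close>: the horofunction on the ball of
  radius \<open>R\<close> decides its values at every point whose Gromov product with the endpoint
  is small, since geodesics from such a point to the endpoint pass through that ball. Its tolerance
  \<open>2 * D\<close> is what two consecutive uses of hyperbolicity cost when a translated geodesic
  is compared with one from the identity. Steps are read from \<open>sig R\<close>, but the points
  to be controlled near the base point may lie \<open>D\<close> further out, so types need
  \<open>sig (R + D)\<close>.\<close>

definition agree :: "nat \<Rightarrow> (nat \<Rightarrow> 'a) \<Rightarrow> (nat \<Rightarrow> 'a) \<Rightarrow> bool" where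
  "agree n a b \<longleftrightarrow> (\<forall>i<n. a i = b i)"

definition sdrop :: "nat \<Rightarrow> (nat \<Rightarrow> 'a) \<Rightarrow> nat \<Rightarrow> 'a" where
  "sdrop n a = (\<lambda>i. a (n + i))"

definition pre :: "'a list \<Rightarrow> (nat \<Rightarrow> 'a) \<Rightarrow> bool" where
  "pre w a \<longleftrightarrow> (\<forall>i<length w. w ! i = a i)"

lemma agree_refl [simp]: "agree n a a"
  by (simp add: agree_def)

lemma agree_sym: "agree n a b \<Longrightarrow> agree n b a"
  by (simp add: agree_def)

lemma agree_mono: "agree n a b \<Longrightarrow> m \<le> n \<Longrightarrow> agree m a b"
  by (simp add: agree_def)

lemma agree_0 [simp]: "agree 0 a b"
  by (simp add: agree_def)

lemma agree_Suc: "agree (Suc n) a b \<longleftrightarrow> agree n a b \<and> a n = b n"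
  by (auto simp: agree_def less_Suc_eq)

lemma agree_add: "agree (m + n) a b \<longleftrightarrow> agree m a b \<and> agree n (sdrop m a) (sdrop m b)"
proof -
  have "i < m \<or> (\<exists>j<n. i = m + j)" if "i < m + n" for i
    using that by presburger
  then show ?thesis
    unfolding agree_def sdrop_def by (metis add_less_cancel_left trans_less_add1)
qed

lemma agree_all_eq:
  assumes "\<And>n. agree n a b"
  shows "a = b"
proof
  show "a i = b i" for i using assms[of "Suc i"] by (simp add: agree_Suc)
qed

lemma agree_sdrop_eq:
  assumes "agree n a b" "sdrop n a = sdrop n b"
  shows "a = b"
proof
  fix i
  show "a i = b i"
    using assms(1) fun_cong[OF assms(2), of "i - n"] by (cases "i < n") (simp_all add: agree_def sdrop_def)
qed

lemma sdrop_0 [simp]: "sdrop 0 a = a"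
  by (simp add: sdrop_def)

lemma sdrop_sdrop: "sdrop m (sdrop n a) = sdrop (n + m) a"
  by (simp add: sdrop_def add.assoc)

lemma pre_append: "pre (v @ w) a \<longleftrightarrow> pre v a \<and> pre w (sdrop (length v) a)"
proof -
  have split: "(\<forall>i<m + n. R i) \<longleftrightarrow> (\<forall>i<m. R i) \<and> (\<forall>j<n. R (m + j))" for m n :: nat and R
  proof -
    have "i < m \<or> (\<exists>j<n. i = m + j)" if "i < m + n" for i
      using that by presburger
    then show ?thesis by (metis add_less_cancel_left trans_less_add1)
  qed
  show ?thesis
    unfolding pre_def sdrop_def length_append split by (simp add: nth_append)
qed

lemma pre_agree: "pre w a \<Longrightarrow> agree (length w) a b \<Longrightarrow> pre w b"
  by (simp add: pre_def agree_def)

lemma pre_imp_agree: "pre w a \<Longrightarrow> pre w b \<Longrightarrow> agree (length w) a b"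
  by (simp add: pre_def agree_def)

section \<open>Longest common prefixes and transducers\<close>

text \<open>For a set with fewer than two elements the \<open>LEAST\<close> is unspecified. Members
  still agree up to it, but its being a position of disagreement requires two distinct members,
  whence the hypotheses on \<open>b0\<close> and \<open>b1\<close> below.\<close>

definition lcplen :: "(nat \<Rightarrow> 'a) set \<Rightarrow> nat" where
  "lcplen B = (LEAST i. \<exists>b\<in>B. \<exists>b'\<in>B. b i \<noteq> b' i)"

lemma lcplen_agree: "b \<in> B \<Longrightarrow> b' \<in> B \<Longrightarrow> agree (lcplen B) b b'"
  unfolding agree_def lcplen_def using not_less_Least by blast

lemma lcplen_diff:
  assumes "b0 \<in> B" "b1 \<in> B" "b0 \<noteq> b1"
  shows "\<exists>b\<in>B. \<exists>b'\<in>B. b (lcplen B) \<noteq> b' (lcplen B)"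
proof -
  obtain i where "b0 i \<noteq> b1 i" using assms(3) by auto
  then have "\<exists>i. \<exists>b\<in>B. \<exists>b'\<in>B. b i \<noteq> b' i" using assms(1,2) by blast
  then show ?thesis unfolding lcplen_def by (rule LeastI_ex)
qed

lemma lcplen_ge:
  assumes "b0 \<in> B" "b1 \<in> B" "b0 \<noteq> b1" "\<And>b b'. b \<in> B \<Longrightarrow> b' \<in> B \<Longrightarrow> agree k b b'"
  shows "k \<le> lcplen B"
  using lcplen_diff[OF assms(1-3)] assms(4) unfolding agree_def by (meson not_less)

lemma lcplen_eqI:
  assumes "b0 \<in> B" "b1 \<in> B" "b0 l \<noteq> b1 l" "\<And>b b'. b \<in> B \<Longrightarrow> b' \<in> B \<Longrightarrow> agree l b b'"
  shows "lcplen B = l"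
  unfolding lcplen_def
  using assms by (intro Least_equality) (auto simp: agree_def intro: leI)

text \<open>A common prefix may be removed in stages. This lets a transducer emit in increments and
  makes the fully stripped remainder independent of what was removed earlier.\<close>

lemma lcplen_sdrop:
  assumes ne: "b0 \<in> B" "b1 \<in> B" "b0 \<noteq> b1"
    and u: "\<And>b b'. b \<in> B \<Longrightarrow> b' \<in> B \<Longrightarrow> agree u b b'"
  shows "lcplen B = u + lcplen (sdrop u ` B)"
proof -
  let ?C = "sdrop u ` B"
  have ne': "sdrop u b0 \<in> ?C" "sdrop u b1 \<in> ?C" "sdrop u b0 \<noteq> sdrop u b1"
    using ne u agree_sdrop_eq by blast+
  obtain c c' where c: "c \<in> ?C" "c' \<in> ?C" "c (lcplen ?C) \<noteq> c' (lcplen ?C)"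
    using lcplen_diff[OF ne'] by blast
  then obtain b b' where b: "b \<in> B" "b' \<in> B" "c = sdrop u b" "c' = sdrop u b'" by blast
  show ?thesis
  proof (rule lcplen_eqI[OF b(1,2)])
    show "b (u + lcplen ?C) \<noteq> b' (u + lcplen ?C)"
      using c b by (simp add: sdrop_def)
    show "agree (u + lcplen ?C) b b'" if "b \<in> B" "b' \<in> B" for b b'
      using that u lcplen_agree[of "sdrop u b" ?C "sdrop u b'"] by (simp add: agree_add)
  qed
qed

section \<open>Transducers: dependence on finite prefixes, numbering of states, continuity\<close>

lemma trans_state_cong:
  "agree n \<psi> \<phi> \<Longrightarrow> trans_state t q \<psi> n = trans_state t q \<phi> n"
  by (induction n) (auto simp: agree_Suc)

lemma trans_out_prefix_Suc:
  "trans_out_prefix t out q \<psi> (Suc n)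
   = trans_out_prefix t out q \<psi> n @ out (trans_state t q \<psi> n) (\<psi> n)"
  by (simp add: trans_out_prefix_def)

lemma trans_out_prefix_cong:
  "agree n \<psi> \<phi> \<Longrightarrow> trans_out_prefix t out q \<psi> n = trans_out_prefix t out q \<phi> n"
proof (induction n)
  case 0
  then show ?case by (simp add: trans_out_prefix_def)
next
  case (Suc n)
  then show ?case
    by (auto simp: agree_Suc trans_out_prefix_Suc intro: trans_state_cong dest: trans_state_cong[of n \<psi> \<phi> t q])
qed

text \<open>The states built below are sets of pairs of sequences, while \<open>rational_fun\<close>
  asks for numbers; an injection of the finite state set into \<open>nat\<close> transports the
  machine.\<close>

lemma rational_funI:
  fixes Q :: "'q set"
  assumes fin: "finite Q" and q0: "q0 \<in> Q" and t: "\<And>q a. q \<in> Q \<Longrightarrow> t q a \<in> Q"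
    and nd: "nondegenerate t out q0" and o: "\<And>\<psi>. outputs t out q0 \<psi> (f \<psi>)"
  shows "rational_fun f"
proof -
  obtain e :: "'q \<Rightarrow> nat" where e: "inj_on e Q"
    using finite_imp_inj_to_nat_seg[OF fin] by blast
  let ?d = "inv_into Q e"
  let ?t = "\<lambda>q a. e (t (?d q) a)" and ?o = "\<lambda>q a. out (?d q) a"
  have st: "trans_state ?t (e q0) \<psi> n = e (trans_state t q0 \<psi> n) \<and> trans_state t q0 \<psi> n \<in> Q" for \<psi> n
    by (induction n) (auto simp: q0 t inv_into_f_f[OF e])
  then have pr: "trans_out_prefix ?t ?o (e q0) \<psi> n = trans_out_prefix t out q0 \<psi> n" for \<psi> n
    by (simp add: trans_out_prefix_def inv_into_f_f[OF e])
  have "transducer (e ` Q) (e q0) ?t ?o"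
    using fin q0 t by (auto simp: transducer_def inv_into_f_f[OF e])
  moreover have "nondegenerate ?t ?o (e q0)" using nd by (simp add: nondegenerate_def pr)
  moreover have "outputs ?t ?o (e q0) \<psi> (f \<psi>)" for \<psi> using o by (simp add: outputs_def pr)
  ultimately show ?thesis unfolding rational_fun_def by blast
qed

text \<open>Nondegeneracy makes each output letter appear after finitely many input letters, and
  these alone determine it. This pointwise condition is the form of continuity used for maps on
  sequences below.\<close>

lemma rational_fun_cont:
  assumes "rational_fun f"
  shows "\<exists>n. \<forall>\<phi>. agree n \<psi> \<phi> \<longrightarrow> f \<phi> k = f \<psi> k"
proof -
  obtain Q q0 t out where nd: "nondegenerate t out q0" and o: "\<And>\<psi>. outputs t out q0 \<psi> (f \<psi>)"
    and "transducer (Q::nat set) q0 t out"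
    using assms unfolding rational_fun_def by blast
  obtain n where n: "length (trans_out_prefix t out q0 \<psi> n) > k"
    using nd unfolding nondegenerate_def by blast
  have "f \<phi> k = f \<psi> k" if "agree n \<psi> \<phi>" for \<phi>
    using o[of \<psi>] o[of \<phi>] trans_out_prefix_cong[OF that, of t out q0] n
    unfolding outputs_def by metis
  then show ?thesis by blast
qed

lemma eq_on_dense:
  fixes f g :: "(nat \<Rightarrow> 'a) \<Rightarrow> nat \<Rightarrow> 'b"
  assumes f: "\<And>\<psi> k. \<exists>n. \<forall>\<phi>. agree n \<psi> \<phi> \<longrightarrow> f \<phi> k = f \<psi> k"
    and g: "\<And>\<psi> k. \<exists>n. \<forall>\<phi>. agree n \<psi> \<phi> \<longrightarrow> g \<phi> k = g \<psi> k"
    and dense: "\<And>\<psi> n. \<exists>a\<in>A. agree n \<psi> a" and eq: "\<And>a. a \<in> A \<Longrightarrow> f a = g a"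
  shows "f = g"
proof (intro ext)
  fix \<psi> k
  obtain n where n: "\<forall>\<phi>. agree n \<psi> \<phi> \<longrightarrow> f \<phi> k = f \<psi> k"
    using f by blast
  obtain m where m: "\<forall>\<phi>. agree m \<psi> \<phi> \<longrightarrow> g \<phi> k = g \<psi> k"
    using g by blast
  obtain a where "a \<in> A" "agree (max n m) \<psi> a" using dense by blast
  then have "a \<in> A" "agree n \<psi> a" "agree m \<psi> a"
    using agree_mono[of "max n m" \<psi> a] by simp_all
  then have "f a k = f \<psi> k" "g a k = g \<psi> k" "f a = g a" using n m eq by blast+
  then show "f \<psi> k = g \<psi> k" by simp
qed

lemma cont_comp:
  assumes g: "\<And>\<psi> k. \<exists>n. \<forall>\<phi>. agree n \<psi> \<phi> \<longrightarrow> g \<phi> k = g \<psi> k"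
    and f: "\<And>\<psi> k. \<exists>n. \<forall>\<phi>. agree n \<psi> \<phi> \<longrightarrow> f \<phi> k = f \<psi> k"
  shows "\<exists>n. \<forall>\<phi>. agree n \<psi> \<phi> \<longrightarrow> g (f \<phi>) k = g (f \<psi>) k"
proof -
  have *: "\<exists>n. \<forall>\<phi>. agree n \<psi> \<phi> \<longrightarrow> agree m (f \<psi>) (f \<phi>)" for m
  proof (induction m)
    case (Suc m)
    obtain n where n: "\<forall>\<phi>. agree n \<psi> \<phi> \<longrightarrow> agree m (f \<psi>) (f \<phi>)" using Suc by blast
    obtain n' where n': "\<forall>\<phi>. agree n' \<psi> \<phi> \<longrightarrow> f \<phi> m = f \<psi> m" using f by blast
    have "agree (Suc m) (f \<psi>) (f \<phi>)" if "agree (max n n') \<psi> \<phi>" for \<phi>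
    proof -
      have "agree n \<psi> \<phi>" "agree n' \<psi> \<phi>" using that agree_mono[of "max n n'" \<psi> \<phi>] by simp_all
      then have "agree m (f \<psi>) (f \<phi>)" "f \<phi> m = f \<psi> m" using n n' by blast+
      then show ?thesis by (simp add: agree_Suc)
    qed
    then show ?case by blast
  qed simp
  obtain m where m: "\<forall>\<phi>. agree m (f \<psi>) \<phi> \<longrightarrow> g \<phi> k = g (f \<psi>) k" using g by blast
  show ?thesis using *[of m] m by blast
qed

lemma openin_cylinder: "openin cantor_top {\<phi>. agree n \<psi> \<phi>}"
proof -
  have "{\<phi>. agree n \<psi> \<phi>} = PiE UNIV (\<lambda>i. if i < n then {\<psi> i} else UNIV)"
    by (auto simp: agree_def PiE_iff split: if_splits)
  moreover have "openin cantor_top (PiE UNIV (\<lambda>i. if i < n then {\<psi> i} else UNIV))"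
    unfolding cantor_top_def
    by (simp add: openin_PiE_gen if_distrib cong: if_cong)
  ultimately show ?thesis by simp
qed

lemma continuous_map_cantor:
  assumes "\<And>\<psi> k. \<exists>n. \<forall>\<phi>. agree n \<psi> \<phi> \<longrightarrow> f \<phi> k = f \<psi> k"
  shows "continuous_map cantor_top cantor_top f"
proof -
  have space: "topspace cantor_top = UNIV" by (simp add: cantor_top_def)
  have "continuous_map cantor_top (discrete_topology UNIV) (\<lambda>\<psi>. f \<psi> k)" for k
    unfolding continuous_map_def
  proof (intro conjI allI impI)
    fix U :: "bool set"
    show "openin cantor_top {\<psi> \<in> topspace cantor_top. f \<psi> k \<in> U}"
    proof (subst openin_subopen, intro ballI)
      fix \<psi> assume *: "\<psi> \<in> {\<psi> \<in> topspace cantor_top. f \<psi> k \<in> U}"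
      obtain n where n: "\<forall>\<phi>. agree n \<psi> \<phi> \<longrightarrow> f \<phi> k = f \<psi> k" using assms by blast
      have "{\<phi>. agree n \<psi> \<phi>} \<subseteq> {\<psi> \<in> topspace cantor_top. f \<psi> k \<in> U}"
      proof
        fix \<phi> assume "\<phi> \<in> {\<phi>. agree n \<psi> \<phi>}"
        then have "f \<phi> k = f \<psi> k" using n by blast
        then show "\<phi> \<in> {\<psi> \<in> topspace cantor_top. f \<psi> k \<in> U}" using * by (simp add: space)
      qed
      then show "\<exists>T. openin cantor_top T \<and> \<psi> \<in> T \<and> T \<subseteq> {\<psi> \<in> topspace cantor_top. f \<psi> k \<in> U}"
        using openin_cylinder[of n \<psi>] by (metis agree_refl mem_Collect_eq)
    qed
  qed simp
  then have "continuous_map cantor_top (product_topology (\<lambda>_. discrete_topology UNIV) UNIV) f"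
    by (simp add: continuous_map_componentwise_UNIV)
  then show ?thesis by (simp add: cantor_top_def)
qed

text \<open>The states of the transducer extending \<open>\<Gamma>\<close> are the restrictions of \<open>\<Gamma>\<close> to cylinders, with the
  longest common prefix of all outputs removed.\<close>

definition strip :: "((nat \<Rightarrow> 'a) \<times> (nat \<Rightarrow> 'b)) set \<Rightarrow> ((nat \<Rightarrow> 'a) \<times> (nat \<Rightarrow> 'b)) set" where
  "strip Z = (\<lambda>(a, b). (a, sdrop (lcplen (snd ` Z)) b)) ` Z"

definition advance :: "((nat \<Rightarrow> 'a) \<times> (nat \<Rightarrow> 'b)) set \<Rightarrow> 'a \<Rightarrow> ((nat \<Rightarrow> 'a) \<times> (nat \<Rightarrow> 'b)) set" where
  "advance Z x = (\<lambda>(a, b). (sdrop 1 a, b)) ` {p \<in> Z. fst p 0 = x}"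

definition lcp_word :: "(nat \<Rightarrow> 'a) set \<Rightarrow> 'a list" where
  "lcp_word B = map (SOME b. b \<in> B) [0..<lcplen B]"

lemma length_lcp_word [simp]: "length (lcp_word B) = lcplen B"
  by (simp add: lcp_word_def)

lemma pre_lcp_word: "b \<in> B \<Longrightarrow> pre (lcp_word B) b"
  using lcplen_agree[OF someI[of "\<lambda>b. b \<in> B"]] by (simp add: pre_def lcp_word_def agree_def)

text \<open>After \<open>n\<close> letters the machine has emitted everything common to the outputs
  over the cylinder, and its state is the remaining map. Density puts both continuations into each
  cylinder, injectivity then gives two different outputs, so the common prefix is finite; continuity
  makes it grow; \<open>local\<close> leaves finitely many remainders.\<close>

lemma rational_extension:
  fixes \<Gamma> :: "((nat \<Rightarrow> bool) \<times> (nat \<Rightarrow> 'b)) set"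
  defines "cyl \<equiv> \<lambda>\<psi> n. {(a, b) \<in> \<Gamma>. agree n a \<psi>}"
  assumes dense: "\<And>\<psi> n. \<exists>a b. (a, b) \<in> \<Gamma> \<and> agree n a \<psi>"
    and cont: "\<And>k. \<exists>n. \<forall>a b a' b'. (a, b) \<in> \<Gamma> \<longrightarrow> (a', b') \<in> \<Gamma> \<longrightarrow> agree n a a' \<longrightarrow> agree k b b'"
    and inj: "\<And>a a' b. (a, b) \<in> \<Gamma> \<Longrightarrow> (a', b) \<in> \<Gamma> \<Longrightarrow> a = a'"
    and fin: "finite locs"
    and local: "\<And>\<psi> n. \<exists>u. (\<forall>(a, b)\<in>cyl \<psi> n. \<forall>(a', b')\<in>cyl \<psi> n. agree u b b')
                  \<and> (\<lambda>(a, b). (sdrop n a, sdrop u b)) ` cyl \<psi> n \<in> locs"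
  shows "\<exists>f. rational_fun f \<and> (\<forall>a b. (a, b) \<in> \<Gamma> \<longrightarrow> f a = b)"
proof -
  \<comment> \<open>No output can precede the first letter, so level 0 is not stripped and the
    initial state is \<open>\<Gamma>\<close> itself. A prefix common to all outputs is emitted with
    the first letter.\<close>
  define P where "P \<psi> n = (if n = 0 then 0 else lcplen (snd ` cyl \<psi> n))" for \<psi> n
  define Q where "Q \<psi> n = (\<lambda>(a, b). (sdrop n a, sdrop (P \<psi> n) b)) ` cyl \<psi> n" for \<psi> n
  define t where "t Z x = strip (advance Z x)" for Z :: "((nat \<Rightarrow> bool) \<times> (nat \<Rightarrow> 'b)) set" and x
  define out where "out Z x = lcp_word (snd ` advance Z x)" for Z :: "((nat \<Rightarrow> bool) \<times> (nat \<Rightarrow> 'b)) set" and x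
  have two: "\<exists>b\<in>snd ` cyl \<psi> n. \<exists>b'\<in>snd ` cyl \<psi> n. b \<noteq> b'" for \<psi> n
  proof -
    \<comment> \<open>Two points of the same cylinder that differ at position \<open>n\<close>; by
      injectivity their outputs differ as well.\<close>
    obtain a b where ab: "(a, b) \<in> \<Gamma>" "agree (Suc n) a \<psi>" using dense by blast
    obtain a' b' where ab': "(a', b') \<in> \<Gamma>" "agree (Suc n) a' (\<psi>(n := \<not> \<psi> n))" using dense by blast
    have "a \<noteq> a'" using ab ab' by (auto simp: agree_Suc)
    then have "b \<noteq> b'" using inj ab ab' by blast
    moreover have "(a, b) \<in> cyl \<psi> n" "(a', b') \<in> cyl \<psi> n"
      using ab ab' by (auto simp: cyl_def agree_def)
    ultimately show ?thesis by (metis image_eqI snd_conv)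
  qed
  have Pag: "agree (P \<psi> n) b b'" if "(a, b) \<in> cyl \<psi> n" "(a', b') \<in> cyl \<psi> n" for a b a' b' \<psi> n
    using that lcplen_agree[of b "snd ` cyl \<psi> n" b'] by (force simp: P_def)
  have cylS: "cyl \<psi> (Suc n) = {p \<in> cyl \<psi> n. fst p n = \<psi> n}" for \<psi> n
    by (auto simp: cyl_def agree_Suc)
  have adv: "advance (Q \<psi> n) (\<psi> n) = (\<lambda>(a, b). (sdrop (Suc n) a, sdrop (P \<psi> n) b)) ` cyl \<psi> (Suc n)" for \<psi> n
  proof -
    have "{p \<in> Q \<psi> n. fst p 0 = \<psi> n} = (\<lambda>(a, b). (sdrop n a, sdrop (P \<psi> n) b)) ` cyl \<psi> (Suc n)"
      unfolding Q_def cylS by (auto simp: sdrop_def)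
    then show ?thesis
      unfolding advance_def by (simp add: image_image split_beta sdrop_sdrop)
  qed
  have snd_adv: "snd ` advance (Q \<psi> n) (\<psi> n) = sdrop (P \<psi> n) ` snd ` cyl \<psi> (Suc n)" for \<psi> n
    unfolding adv by (simp add: image_image split_beta)
  have PS: "P \<psi> (Suc n) = P \<psi> n + lcplen (snd ` advance (Q \<psi> n) (\<psi> n))" for \<psi> n
  proof -
    obtain b b' where bb: "b \<in> snd ` cyl \<psi> (Suc n)" "b' \<in> snd ` cyl \<psi> (Suc n)" "b \<noteq> b'"
      using two by blast
    have "lcplen (snd ` cyl \<psi> (Suc n)) = P \<psi> n + lcplen (sdrop (P \<psi> n) ` snd ` cyl \<psi> (Suc n))"
      by (rule lcplen_sdrop[OF bb]) (use Pag cylS in auto)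
    then show ?thesis by (simp add: P_def[of \<psi> "Suc n"] snd_adv)
  qed
  have QS: "t (Q \<psi> n) (\<psi> n) = Q \<psi> (Suc n)" for \<psi> n
    unfolding t_def strip_def Q_def[of \<psi> "Suc n"] PS
    by (subst (2) adv) (simp add: image_image sdrop_sdrop split_beta)
  have Q0: "Q \<psi> 0 = \<Gamma>" for \<psi>
    by (auto simp: Q_def P_def cyl_def)
  have state: "trans_state t \<Gamma> \<psi> n = Q \<psi> n" for \<psi> n
    by (induction n) (auto simp: Q0 QS)
  have prefix: "length (trans_out_prefix t out \<Gamma> \<psi> n) = P \<psi> n
      \<and> (\<forall>(a, b)\<in>cyl \<psi> n. pre (trans_out_prefix t out \<Gamma> \<psi> n) b)" for \<psi> n
  proof (induction n)
    case 0
    then show ?case by (simp add: trans_out_prefix_def P_def pre_def)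
  next
    case (Suc n)
    have "pre (out (Q \<psi> n) (\<psi> n)) (sdrop (P \<psi> n) b)" if "(a, b) \<in> cyl \<psi> (Suc n)" for a b
      unfolding out_def by (rule pre_lcp_word) (use that in \<open>force simp: snd_adv\<close>)
    then show ?case
      using Suc by (auto simp: trans_out_prefix_Suc state PS out_def pre_append cylS)
  qed
  have Qfin: "Q \<psi> n \<in> insert \<Gamma> (strip ` locs)" for \<psi> n
  proof (cases "n = 0")
    case True
    then show ?thesis by (simp add: Q0)
  next
    case False
    obtain u where u: "\<And>p p'. p \<in> cyl \<psi> n \<Longrightarrow> p' \<in> cyl \<psi> n \<Longrightarrow> agree u (snd p) (snd p')"
      and Z: "(\<lambda>(a, b). (sdrop n a, sdrop u b)) ` cyl \<psi> n \<in> locs" (is "?Z \<in> _")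
      using local[of \<psi> n] by (force simp: split_beta)
    obtain b b' where bb: "b \<in> snd ` cyl \<psi> n" "b' \<in> snd ` cyl \<psi> n" "b \<noteq> b'"
      using two by blast
    \<comment> \<open>The \<open>u\<close> supplied by \<open>local\<close> may be shorter than the
      longest common prefix; \<open>strip\<close> removes the rest, so the state depends only on the
      local action in \<open>locs\<close>.\<close>
    have "lcplen (snd ` cyl \<psi> n) = u + lcplen (sdrop u ` snd ` cyl \<psi> n)"
      by (rule lcplen_sdrop[OF bb]) (use u in blast)
    then have "P \<psi> n = u + lcplen (sdrop u ` snd ` cyl \<psi> n)"
      using False by (simp add: P_def)
    also have "sdrop u ` snd ` cyl \<psi> n = snd ` ?Z"
      by (simp add: image_image split_beta)
    finally have "Q \<psi> n = strip ?Z"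
      unfolding Q_def strip_def by (simp add: image_image sdrop_sdrop split_beta)
    then show ?thesis using Z by blast
  qed
  let ?S = "{Q \<psi> n |\<psi> n. True}"
  have nd: "\<exists>n. length (trans_out_prefix t out \<Gamma> \<psi> n) > k" for \<psi> k
  proof -
    obtain n where n: "\<And>a b a' b'. (a, b) \<in> \<Gamma> \<Longrightarrow> (a', b') \<in> \<Gamma> \<Longrightarrow> agree n a a' \<Longrightarrow> agree (Suc k) b b'"
      using cont by blast
    \<comment> \<open>Level \<open>Suc n\<close> rather than \<open>n\<close>, because
      \<open>P\<close> is set to 0 at level 0.\<close>
    obtain b b' where bb: "b \<in> snd ` cyl \<psi> (Suc n)" "b' \<in> snd ` cyl \<psi> (Suc n)" "b \<noteq> b'"
      using two by blast
    have ag: "agree (Suc k) b b'" if "(a, b) \<in> cyl \<psi> (Suc n)" "(a', b') \<in> cyl \<psi> (Suc n)" for a b a' b'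
      using n[of a b a' b'] that unfolding cyl_def agree_def by simp
    have "Suc k \<le> lcplen (snd ` cyl \<psi> (Suc n))"
      by (rule lcplen_ge[OF bb]) (use ag in auto)
    then show ?thesis using prefix[of \<psi> "Suc n"] by (auto simp: P_def intro!: exI[of _ "Suc n"])
  qed
  define f where "f \<psi> k = trans_out_prefix t out \<Gamma> \<psi> (LEAST n. length (trans_out_prefix t out \<Gamma> \<psi> n) > k) ! k" for \<psi> k
  have "\<exists>w. trans_out_prefix t out \<Gamma> \<psi> (n + m) = trans_out_prefix t out \<Gamma> \<psi> n @ w" for \<psi> n m
    by (induction m) (auto simp: trans_out_prefix_Suc)
  then have mono: "trans_out_prefix t out \<Gamma> \<psi> (n + m) ! k = trans_out_prefix t out \<Gamma> \<psi> n ! k"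
    if "k < length (trans_out_prefix t out \<Gamma> \<psi> n)" for \<psi> n m k
    using that by (metis nth_append)
  have f: "f \<psi> k = trans_out_prefix t out \<Gamma> \<psi> n ! k" if "k < length (trans_out_prefix t out \<Gamma> \<psi> n)" for \<psi> n k
  proof -
    let ?m = "LEAST n. length (trans_out_prefix t out \<Gamma> \<psi> n) > k"
    have "?m \<le> n" "k < length (trans_out_prefix t out \<Gamma> \<psi> ?m)"
      using that by (auto intro: Least_le LeastI)
    then show ?thesis using mono[of k \<psi> ?m "n - ?m"] by (simp add: f_def)
  qed
  have "rational_fun f"
  proof (rule rational_funI[of ?S \<Gamma> t out])
    show "finite ?S"
      by (rule finite_subset[of _ "insert \<Gamma> (strip ` locs)"]) (use Qfin fin in blast, simp add: fin)
    show "\<Gamma> \<in> ?S" using Q0[symmetric] by blast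
    fix q a assume "q \<in> ?S"
    then obtain \<psi> n where q: "q = Q \<psi> n" by blast
    \<comment> \<open>Level \<open>n\<close> does not see position \<open>n\<close>, so every letter
      \<open>a\<close> occurs as the next letter of some sequence leading to the same state.\<close>
    have "cyl (\<psi>(n := a)) n = cyl \<psi> n" unfolding cyl_def agree_def by auto
    then have "q = Q (\<psi>(n := a)) n" unfolding q Q_def P_def by simp
    then have "t q a = Q (\<psi>(n := a)) (Suc n)" using QS[of "\<psi>(n := a)" n] by simp
    then show "t q a \<in> ?S" by blast
  next
    show "nondegenerate t out \<Gamma>" using nd by (simp add: nondegenerate_def)
    show "outputs t out \<Gamma> \<psi> (f \<psi>)" for \<psi> by (simp add: outputs_def f)
  qed
  moreover have "f a = b" if "(a, b) \<in> \<Gamma>" for a b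
  proof
    fix k
    obtain n where n: "length (trans_out_prefix t out \<Gamma> a n) > k" using nd by blast
    have "(a, b) \<in> cyl a n" using that by (simp add: cyl_def)
    then show "f a k = b k" using prefix[of a n] f[OF n] n by (auto simp: pre_def)
  qed
  ultimately show ?thesis by blast
qed

section \<open>Binary coding of itineraries\<close>

text \<open>The unique-existence clause is unique readability and completeness together: every
  binary sequence, not only one coming from an itinerary, starts with exactly one code word. A
  one-letter alphabet is thereby forced to use the empty word, so a letter may contribute no
  bit.\<close>

definition complete_code :: "'l set \<Rightarrow> ('l \<Rightarrow> bool list) \<Rightarrow> bool" where
  "complete_code B \<kappa> \<longleftrightarrow> (\<forall>\<psi>. \<exists>!b. b \<in> B \<and> pre (\<kappa> b) \<psi>) \<and> (2 \<le> card B \<longrightarrow> (\<forall>b\<in>B. \<kappa> b \<noteq> []))"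

lemma complete_code_ex:
  assumes "finite B" "B \<noteq> {}"
  shows "\<exists>\<kappa>. complete_code B \<kappa>"
  using assms
proof (induction B rule: finite_ne_induct)
  case (singleton x)
  show ?case by (intro exI[of _ "\<lambda>_. []"]) (simp add: complete_code_def pre_def)
next
  case (insert x B)
  obtain \<kappa> where \<kappa>: "complete_code B \<kappa>" using insert.IH by (rule exE)
  define \<kappa>' where "\<kappa>' b = (if b = x then [True] else False # \<kappa> b)" for b
  have Cons: "pre (c # w) \<psi> \<longleftrightarrow> c = \<psi> 0 \<and> pre w (sdrop 1 \<psi>)" for c w and \<psi> :: "nat \<Rightarrow> bool"
    using pre_append[of "[c]" w \<psi>] by (simp add: pre_def)
  have Nil: "pre [] \<psi>" for \<psi> :: "nat \<Rightarrow> bool"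
    by (simp add: pre_def)
  have "\<exists>!b. b \<in> insert x B \<and> pre (\<kappa>' b) \<psi>" for \<psi>
  proof (cases "\<psi> 0")
    case True
    then show ?thesis by (auto simp: \<kappa>'_def Cons Nil split: if_splits)
  next
    case False
    have "\<exists>!b. b \<in> B \<and> pre (\<kappa> b) (sdrop 1 \<psi>)" using \<kappa> by (simp add: complete_code_def)
    moreover have "b \<in> insert x B \<and> pre (\<kappa>' b) \<psi> \<longleftrightarrow> b \<in> B \<and> pre (\<kappa> b) (sdrop 1 \<psi>)" for b
      using False insert.hyps by (auto simp: \<kappa>'_def Cons)
    ultimately show ?thesis by simp
  qed
  moreover have "\<kappa>' b \<noteq> []" for b by (simp add: \<kappa>'_def)
  ultimately show ?case unfolding complete_code_def by blast
qed

text \<open>The code is a function of the alphabet alone, so cones with the same follower set are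
  coded alike.\<close>

definition code_word :: "'l set \<Rightarrow> 'l \<Rightarrow> bool list" where
  "code_word B = (SOME \<kappa>. complete_code B \<kappa>)"

lemma complete_code_word: "finite B \<Longrightarrow> B \<noteq> {} \<Longrightarrow> complete_code B (code_word B)"
  by (simp add: code_word_def someI_ex[OF complete_code_ex])

lemma code_word_ex1: "finite B \<Longrightarrow> B \<noteq> {} \<Longrightarrow> \<exists>!b. b \<in> B \<and> pre (code_word B b) \<psi>"
  using complete_code_word[of B] by (simp add: complete_code_def)

lemma code_word_nonempty:
  "finite B \<Longrightarrow> B \<noteq> {} \<Longrightarrow> 2 \<le> card B \<Longrightarrow> b \<in> B \<Longrightarrow> code_word B b \<noteq> []"
  using complete_code_word[of B] by (simp add: complete_code_def)

section \<open>Itineraries, cones and their binary codes\<close>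

locale shift_coding =
  fixes Om :: "'o set" and s :: "'o \<Rightarrow> 'o" and l :: "'o \<Rightarrow> 'l"
begin

definition itin :: "'o \<Rightarrow> nat \<Rightarrow> 'l" where
  "itin \<omega> n = l ((s ^^ n) \<omega>)"

definition cone :: "'o \<Rightarrow> nat \<Rightarrow> 'o set" where
  "cone \<omega> n = {\<omega>' \<in> Om. agree n (itin \<omega>') (itin \<omega>)}"

definition cone_type :: "'o \<Rightarrow> nat \<Rightarrow> 'o set" where
  "cone_type \<omega> n = (s ^^ n) ` cone \<omega> n"

text \<open>Computes the cone type from letters alone (\<open>cone_type_follow\<close>). The
  starting set is a parameter so that the computation can restart after any number of
  letters.\<close>

fun follow :: "'o set \<Rightarrow> (nat \<Rightarrow> 'l) \<Rightarrow> nat \<Rightarrow> 'o set" where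
  "follow P xs 0 = P"
| "follow P xs (Suc n) = s ` {x \<in> follow P xs n. l x = xs n}"

fun code :: "'o set \<Rightarrow> (nat \<Rightarrow> 'l) \<Rightarrow> nat \<Rightarrow> bool list" where
  "code P xs 0 = []"
| "code P xs (Suc n) = code P xs n @ code_word (l ` follow P xs n) (xs n)"

text \<open>Any sufficiently long finite code gives the same bit (\<open>code_lim_nth\<close>); bits
  beyond a bounded code would be unspecified.\<close>

definition code_lim :: "'o set \<Rightarrow> (nat \<Rightarrow> 'l) \<Rightarrow> nat \<Rightarrow> bool" where
  "code_lim P xs i = code P xs (LEAST n. i < length (code P xs n)) ! i"

definition K :: "'o \<Rightarrow> nat \<Rightarrow> bool" where
  "K \<omega> = code_lim Om (itin \<omega>)"

lemma itin_shift: "itin ((s ^^ n) \<omega>) = sdrop n (itin \<omega>)"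
  by (rule ext) (simp add: itin_def sdrop_def funpow_add add.commute[of n])

lemma cone_Suc: "cone \<omega> (Suc n) = {\<omega>' \<in> cone \<omega> n. itin \<omega>' n = itin \<omega> n}"
  by (auto simp: cone_def agree_Suc)

lemma cone_self: "\<omega> \<in> Om \<Longrightarrow> \<omega> \<in> cone \<omega> n"
  by (simp add: cone_def)

lemma cone_Om: "\<omega>' \<in> cone \<omega> n \<Longrightarrow> \<omega>' \<in> Om"
  by (simp add: cone_def)

lemma cone_agree: "\<omega>' \<in> cone \<omega> n \<Longrightarrow> agree n (itin \<omega>') (itin \<omega>)"
  by (simp add: cone_def)

lemma cone_type_follow: "cone_type \<omega> n = follow Om (itin \<omega>) n"
proof (induction n)
  case 0
  then show ?case by (simp add: cone_type_def cone_def)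
next
  case (Suc n)
  have "cone_type \<omega> (Suc n) = s ` (s ^^ n) ` {\<omega>' \<in> cone \<omega> n. l ((s ^^ n) \<omega>') = itin \<omega> n}"
    by (simp add: cone_type_def cone_Suc image_image itin_def)
  also have "\<dots> = s ` {x \<in> cone_type \<omega> n. l x = itin \<omega> n}"
    by (auto simp: cone_type_def)
  finally show ?case using Suc by simp
qed

lemma follow_add: "follow P xs (m + n) = follow (follow P xs m) (sdrop m xs) n"
  by (induction n) (auto simp: sdrop_def)

lemma code_add: "code P xs (m + n) = code P xs m @ code (follow P xs m) (sdrop m xs) n"
  by (induction n) (simp_all add: follow_add sdrop_def)

lemma follow_cong: "agree n xs ys \<Longrightarrow> follow P xs n = follow P ys n"
  by (induction n) (auto simp: agree_Suc)

lemma code_cong: "agree n xs ys \<Longrightarrow> code P xs n = code P ys n"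
proof (induction n)
  case (Suc n)
  then show ?case using follow_cong[of n xs ys P] by (simp add: agree_Suc)
qed simp

lemma length_code_mono: "m \<le> n \<Longrightarrow> length (code P xs m) \<le> length (code P xs n)"
  using code_add[of P xs m "n - m"] by simp

lemma code_lim_nth:
  assumes "i < length (code P xs n)"
  shows "code_lim P xs i = code P xs n ! i"
proof -
  let ?m = "LEAST n. i < length (code P xs n)"
  have "?m \<le> n" "i < length (code P xs ?m)"
    using assms by (auto intro: Least_le LeastI)
  then show ?thesis
    using code_add[of P xs ?m "n - ?m"] by (simp add: code_lim_def nth_append)
qed

lemma pre_code_lim: "pre (code P xs n) (code_lim P xs)"
  by (simp add: pre_def code_lim_nth)

text \<open>Self-similarity of the code: what follows the first \<open>m\<close> blocks depends only
  on the type reached and the shifted itinerary. This is what makes local actions repeat.\<close>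

lemma sdrop_code_lim:
  assumes unb: "\<And>k. \<exists>n. k < length (code P xs n)"
  shows "sdrop (length (code P xs m)) (code_lim P xs) = code_lim (follow P xs m) (sdrop m xs)"
proof
  fix i
  obtain n where n: "length (code P xs m) + i < length (code P xs n)" using unb by blast
  have "length (code P xs n) \<le> length (code P xs (m + n))" by (rule length_code_mono) simp
  then have i: "length (code P xs m) + i < length (code P xs (m + n))" using n by simp
  then have "i < length (code (follow P xs m) (sdrop m xs) n)" by (simp add: code_add)
  then show "sdrop (length (code P xs m)) (code_lim P xs) i = code_lim (follow P xs m) (sdrop m xs) i"
    using code_lim_nth[OF i] code_lim_nth[of i "follow P xs m" "sdrop m xs" n]
    by (simp add: sdrop_def code_add)
qed

end

text \<open>The assumptions form a second locale because they speak of \<open>cone\<close> and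
  \<open>cone_type\<close>, and verifying them for the group requires computing those sets.\<close>

locale perfect_shift_coding = shift_coding Om s l
  for Om :: "'o set" and s :: "'o \<Rightarrow> 'o" and l :: "'o \<Rightarrow> 'l" +
  assumes Om_nonempty: "Om \<noteq> {}"
    and s_closed: "\<omega> \<in> Om \<Longrightarrow> s \<omega> \<in> Om"
    and finite_letters: "finite (l ` Om)"
    and finite_types: "finite {cone_type \<omega> n |\<omega> n. \<omega> \<in> Om}"
    and perfect: "\<omega> \<in> Om \<Longrightarrow> \<exists>\<omega>'\<in>cone \<omega> n. itin \<omega>' \<noteq> itin \<omega>"
begin

lemma iter_closed: "\<omega> \<in> Om \<Longrightarrow> (s ^^ n) \<omega> \<in> Om"
  by (induction n) (auto simp: s_closed)

lemma cone_type_sub: "cone_type \<omega> n \<subseteq> Om"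
  by (auto simp: cone_type_def cone_def iter_closed)

lemma finite_next: "finite (l ` cone_type \<omega> n)"
  by (rule finite_subset[OF image_mono[OF cone_type_sub] finite_letters])

lemma itin_in_next: "\<omega>' \<in> cone \<omega> n \<Longrightarrow> itin \<omega>' n \<in> l ` cone_type \<omega> n"
  by (auto simp: itin_def cone_type_def)

lemma itin_next: "\<omega> \<in> Om \<Longrightarrow> itin \<omega> n \<in> l ` cone_type \<omega> n"
  by (rule itin_in_next[OF cone_self])

lemma next_nonempty: "\<omega> \<in> Om \<Longrightarrow> l ` cone_type \<omega> n \<noteq> {}"
  using itin_next[of \<omega> n] by auto

lemma cone_type_eq: "\<omega>' \<in> cone \<omega> n \<Longrightarrow> cone_type \<omega>' n = cone_type \<omega> n"
  by (simp add: cone_type_follow follow_cong[OF cone_agree])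

text \<open>How soon a cone branches depends only on its type, so there is a uniform bound.\<close>

lemma gap_ex: "\<exists>J. \<forall>\<omega>\<in>Om. \<forall>n. \<exists>i\<le>J. 2 \<le> card (l ` cone_type \<omega> (n + i))"
proof -
  let ?Ty = "{cone_type \<omega> n |\<omega> n. \<omega> \<in> Om}"
  have "\<forall>P\<in>?Ty. \<exists>j. \<exists>x\<in>P. \<exists>y\<in>P. itin x j \<noteq> itin y j"
  proof
    fix P assume "P \<in> ?Ty"
    then obtain \<omega> n where P: "P = cone_type \<omega> n" "\<omega> \<in> Om" by blast
    obtain \<omega>' where w: "\<omega>' \<in> cone \<omega> n" "itin \<omega>' \<noteq> itin \<omega>" using perfect[OF P(2)] by blast
    have "itin ((s ^^ n) \<omega>') \<noteq> itin ((s ^^ n) \<omega>)"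
      using w agree_sdrop_eq[OF cone_agree[OF w(1)]] by (auto simp: itin_shift)
    then obtain j where "itin ((s ^^ n) \<omega>') j \<noteq> itin ((s ^^ n) \<omega>) j" by auto
    moreover have "(s ^^ n) \<omega>' \<in> P" "(s ^^ n) \<omega> \<in> P"
      using w(1) cone_self[OF P(2)] by (auto simp: P cone_type_def)
    ultimately show "\<exists>j. \<exists>x\<in>P. \<exists>y\<in>P. itin x j \<noteq> itin y j" by blast
  qed
  from bchoice[OF this]
  obtain j where j: "\<forall>P\<in>?Ty. \<exists>x\<in>P. \<exists>y\<in>P. itin x (j P) \<noteq> itin y (j P)" by (rule exE)
  define J where "J = Max (j ` ?Ty)"
  have "\<exists>i\<le>J. 2 \<le> card (l ` cone_type \<omega> (n + i))" if w: "\<omega> \<in> Om" for \<omega> n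
  proof (rule ccontr)
    assume "\<not> ?thesis"
    then have small: "card (l ` cone_type \<omega> (n + i)) \<le> 1" if "i \<le> J" for i
    proof -
      have "\<not> 2 \<le> card (l ` cone_type \<omega> (n + i))"
        using \<open>\<not> (\<exists>i\<le>J. 2 \<le> card (l ` cone_type \<omega> (n + i)))\<close> that by blast
      then show ?thesis by simp
    qed
    \<comment> \<open>With at most one possible letter at each of the times \<open>n\<close> to
      \<open>n + J\<close>, the whole cone moves together for \<open>Suc J\<close> letters, while
      \<open>j\<close> separates two of its points by time \<open>J\<close>.\<close>
    have stay: "\<omega>' \<in> cone \<omega> (n + i)" if "\<omega>' \<in> cone \<omega> n" "i \<le> Suc J" for \<omega>' i
      using that(2)
    proof (induction i)
      case (Suc i)
      then have "\<omega>' \<in> cone \<omega> (n + i)" "card (l ` cone_type \<omega> (n + i)) \<le> 1" using small by auto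
      moreover have "itin \<omega>' (n + i) = itin \<omega> (n + i)"
        using card_le_Suc0_iff_eq[OF finite_next, of \<omega> "n + i"] calculation
          itin_in_next[of \<omega>' \<omega> "n + i"] itin_next[OF w, of "n + i"] by (metis One_nat_def)
      ultimately show ?case by (simp add: cone_Suc)
    qed (use that in simp)
    have P: "cone_type \<omega> n \<in> ?Ty" using w by blast
    obtain x y where e: "x \<in> cone_type \<omega> n" "y \<in> cone_type \<omega> n"
      "itin x (j (cone_type \<omega> n)) \<noteq> itin y (j (cone_type \<omega> n))"
      using bspec[OF j P] by blast
    have jJ: "j (cone_type \<omega> n) \<le> J" unfolding J_def using finite_types P by (intro Max_ge) auto
    have "itin x (j (cone_type \<omega> n)) = itin \<omega> (n + j (cone_type \<omega> n))" if x: "x \<in> cone_type \<omega> n" for x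
    proof -
      obtain \<omega>' where w': "\<omega>' \<in> cone \<omega> n" "x = (s ^^ n) \<omega>'" using x by (auto simp: cone_type_def)
      have "agree (n + Suc J) (itin \<omega>') (itin \<omega>)"
        using cone_agree[OF stay[OF w'(1), of "Suc J"]] by simp
      then show ?thesis using jJ by (simp add: w'(2) itin_shift sdrop_def agree_def)
    qed
    then show False using e by metis
  qed
  then show ?thesis by blast
qed

definition gap :: nat where
  "gap = Suc (SOME J. \<forall>\<omega>\<in>Om. \<forall>n. \<exists>i\<le>J. 2 \<le> card (l ` cone_type \<omega> (n + i)))"

lemma gap: "\<omega> \<in> Om \<Longrightarrow> \<exists>i<gap. 2 \<le> card (l ` cone_type \<omega> (n + i))"
  using someI_ex[OF gap_ex] unfolding gap_def by (auto simp: less_Suc_eq_le)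

text \<open>Each window of \<open>gap\<close> letters contains a branching, and a branching letter
  has a nonempty code word.\<close>

lemma length_code_ge:
  assumes w: "\<omega> \<in> Om"
  shows "k \<le> length (code Om (itin \<omega>) (k * gap))"
proof (induction k)
  case (Suc k)
  obtain i where i: "i < gap" "2 \<le> card (l ` cone_type \<omega> (k * gap + i))" using gap[OF w] by blast
  have "length (code Om (itin \<omega>) (k * gap)) \<le> length (code Om (itin \<omega>) (k * gap + i))"
    by (rule length_code_mono) simp
  also have "\<dots> < length (code Om (itin \<omega>) (Suc (k * gap + i)))"
    using code_word_nonempty[OF finite_next next_nonempty[OF w] i(2) itin_next[OF w]]
    by (simp add: cone_type_follow)
  also have "\<dots> \<le> length (code Om (itin \<omega>) (Suc k * gap))"
    by (rule length_code_mono) (use i in simp)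
  finally show ?case using Suc by simp
qed simp

lemma code_unbounded: "\<omega> \<in> Om \<Longrightarrow> \<exists>n. k < length (code Om (itin \<omega>) n)"
  using length_code_ge[of \<omega> "Suc k"] Suc_le_lessD by blast

lemma sdrop_K:
  assumes "\<omega> \<in> Om"
  shows "sdrop (length (code Om (itin \<omega>) m)) (K \<omega>) = code_lim (cone_type \<omega> m) (itin ((s ^^ m) \<omega>))"
  unfolding K_def cone_type_follow itin_shift by (rule sdrop_code_lim) (rule code_unbounded[OF assms])

text \<open>Decoding letter by letter: as long as the letters agree, the alphabets and hence the
  codes agree, and two words of one code that begin the same sequence belong to the same
  letter.\<close>

lemma pre_code_K_iff:
  assumes w: "\<omega> \<in> Om" and w': "\<omega>' \<in> Om"
  shows "pre (code Om (itin \<omega>) n) (K \<omega>') \<longleftrightarrow> \<omega>' \<in> cone \<omega> n"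
proof
  assume "\<omega>' \<in> cone \<omega> n"
  then have "code Om (itin \<omega>) n = code Om (itin \<omega>') n" using code_cong[OF cone_agree] by simp
  then show "pre (code Om (itin \<omega>) n) (K \<omega>')" by (simp add: K_def pre_code_lim)
next
  show "pre (code Om (itin \<omega>) n) (K \<omega>') \<Longrightarrow> \<omega>' \<in> cone \<omega> n"
  proof (induction n)
    case 0
    then show ?case using w' by (simp add: cone_def)
  next
    case (Suc n)
    then have c: "\<omega>' \<in> cone \<omega> n" by (simp add: pre_append)
    then have eq: "code Om (itin \<omega>') n = code Om (itin \<omega>) n" "cone_type \<omega>' n = cone_type \<omega> n"
      using code_cong[OF cone_agree] cone_type_eq by auto
    let ?\<psi> = "sdrop (length (code Om (itin \<omega>) n)) (K \<omega>')"
    have "pre (code_word (l ` cone_type \<omega> n) (itin \<omega> n)) ?\<psi>"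
      using Suc.prems by (simp add: pre_append cone_type_follow)
    moreover have "pre (code_word (l ` cone_type \<omega> n) (itin \<omega>' n)) ?\<psi>"
      using pre_code_lim[of Om "itin \<omega>'" "Suc n"] by (simp add: pre_append cone_type_follow[symmetric] eq K_def)
    ultimately have "itin \<omega> n = itin \<omega>' n"
      using code_word_ex1[OF finite_next next_nonempty[OF w], of n ?\<psi>] itin_next[OF w, of n] itin_in_next[OF c]
      by blast
    then show ?case using c by (simp add: cone_Suc)
  qed
qed

text \<open>Completeness of the codes lets any binary sequence be parsed into letters, each finite
  parse being realised by a point. Parsing \<open>n * gap\<close> letters covers \<open>n\<close>
  bits; no limit of parses is taken.\<close>

lemma K_dense: "\<exists>\<omega>\<in>Om. agree n (K \<omega>) \<psi>"
proof -
  have "\<exists>\<omega>\<in>Om. pre (code Om (itin \<omega>) m) \<psi>" for m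
  proof (induction m)
    case 0
    then show ?case using Om_nonempty by (auto simp: pre_def)
  next
    case (Suc m)
    then obtain \<omega> where w: "\<omega> \<in> Om" "pre (code Om (itin \<omega>) m) \<psi>" by blast
    let ?\<psi> = "sdrop (length (code Om (itin \<omega>) m)) \<psi>"
    obtain a where a: "a \<in> l ` cone_type \<omega> m" "pre (code_word (l ` cone_type \<omega> m) a) ?\<psi>"
      using code_word_ex1[OF finite_next next_nonempty[OF w(1)], of m ?\<psi>] by blast
    obtain \<omega>' where w': "\<omega>' \<in> cone \<omega> m" "itin \<omega>' m = a"
      using a(1) by (auto simp: cone_type_def itin_def)
    then have "code Om (itin \<omega>') m = code Om (itin \<omega>) m" "cone_type \<omega>' m = cone_type \<omega> m"
      using code_cong[OF cone_agree] cone_type_eq by auto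
    then have "pre (code Om (itin \<omega>') (Suc m)) \<psi>"
      using w a w' by (simp add: pre_append cone_type_follow[symmetric])
    then show ?case using cone_Om[OF w'(1)] by blast
  qed
  then obtain \<omega> where w: "\<omega> \<in> Om" "pre (code Om (itin \<omega>) (n * gap)) \<psi>" by blast
  have "pre (code Om (itin \<omega>) (n * gap)) (K \<omega>)" by (simp add: K_def pre_code_lim)
  then have "agree (length (code Om (itin \<omega>) (n * gap))) (K \<omega>) \<psi>" using w(2) by (rule pre_imp_agree)
  then have "agree n (K \<omega>) \<psi>" by (rule agree_mono) (rule length_code_ge[OF w(1)])
  then show ?thesis using w(1) by blast
qed

lemma block_bound: "\<exists>M. \<forall>\<omega>\<in>Om. \<forall>n. length (code Om (itin \<omega>) (Suc n)) \<le> length (code Om (itin \<omega>) n) + M"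
proof -
  let ?W = "(\<lambda>(B, a). length (code_word B a)) ` (Pow (l ` Om) \<times> (l ` Om))"
  have "finite ?W" using finite_letters by simp
  moreover have "length (code_word (l ` cone_type \<omega> n) (itin \<omega> n)) \<in> ?W" if "\<omega> \<in> Om" for \<omega> n
    using cone_type_sub[of \<omega> n] itin_next[OF that, of n]
    by (intro image_eqI[of _ _ "(l ` cone_type \<omega> n, itin \<omega> n)"]) auto
  ultimately have "length (code_word (l ` cone_type \<omega> n) (itin \<omega> n)) \<le> Max ?W" if "\<omega> \<in> Om" for \<omega> n
    using that by (intro Max_ge)
  then show ?thesis by (auto simp: cone_type_follow)
qed

lemma length_code_le: "\<exists>M. \<forall>\<omega>\<in>Om. \<forall>n. length (code Om (itin \<omega>) n) \<le> n * M"
proof -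
  obtain M where M: "\<And>\<omega> n. \<omega> \<in> Om \<Longrightarrow> length (code Om (itin \<omega>) (Suc n)) \<le> length (code Om (itin \<omega>) n) + M"
    using block_bound by blast
  have "length (code Om (itin \<omega>) n) \<le> n * M" if "\<omega> \<in> Om" for \<omega> n
  proof (induction n)
    case (Suc n)
    then show ?case using M[OF that, of n] by (simp del: code.simps(2))
  qed simp
  then show ?thesis by blast
qed

text \<open>Blocks have bounded length, because there are finitely many alphabets and letters; so a
  fixed number of bits determines the first \<open>n\<close> letters.\<close>

lemma itin_agree_from_K: "\<exists>m. \<forall>\<omega>\<in>Om. \<forall>\<omega>'\<in>Om. agree m (K \<omega>') (K \<omega>) \<longrightarrow> \<omega>' \<in> cone \<omega> n"
proof -
  obtain M where M: "\<And>\<omega> n. \<omega> \<in> Om \<Longrightarrow> length (code Om (itin \<omega>) n) \<le> n * M"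
    using length_code_le by blast
  have "\<omega>' \<in> cone \<omega> n" if "\<omega> \<in> Om" "\<omega>' \<in> Om" "agree (n * M) (K \<omega>') (K \<omega>)" for \<omega> \<omega>'
  proof -
    have "agree (length (code Om (itin \<omega>) n)) (K \<omega>) (K \<omega>')"
      by (rule agree_mono[OF agree_sym[OF that(3)] M[OF that(1)]])
    moreover have "pre (code Om (itin \<omega>) n) (K \<omega>)" by (simp add: K_def pre_code_lim)
    ultimately show ?thesis using pre_agree pre_code_K_iff[OF that(1,2)] by blast
  qed
  then show ?thesis by blast
qed

lemma K_agree_from_itin:
  assumes w: "\<omega> \<in> Om" "\<omega>' \<in> cone \<omega> (n * gap)"
  shows "agree n (K \<omega>') (K \<omega>)"
proof -
  have w': "\<omega>' \<in> Om" by (rule cone_Om[OF w(2)])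
  have "pre (code Om (itin \<omega>) (n * gap)) (K \<omega>')" "pre (code Om (itin \<omega>) (n * gap)) (K \<omega>)"
    using w(2) pre_code_K_iff[OF w(1) w'] by (simp_all add: K_def pre_code_lim)
  then have "agree (length (code Om (itin \<omega>) (n * gap))) (K \<omega>') (K \<omega>)" by (rule pre_imp_agree)
  then show ?thesis by (rule agree_mono) (rule length_code_ge[OF w(1)])
qed

lemma K_eq_iff:
  assumes "\<omega> \<in> Om" "\<omega>' \<in> Om"
  shows "K \<omega> = K \<omega>' \<longleftrightarrow> itin \<omega> = itin \<omega>'"
proof
  assume eq: "K \<omega> = K \<omega>'"
  have "agree n (itin \<omega>) (itin \<omega>')" for n
  proof -
    obtain m where "\<forall>\<omega>\<in>Om. \<forall>\<omega>'\<in>Om. agree m (K \<omega>') (K \<omega>) \<longrightarrow> \<omega>' \<in> cone \<omega> n"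
      using itin_agree_from_K by blast
    then have "\<omega> \<in> cone \<omega>' n" using assms eq by simp
    then show ?thesis by (rule cone_agree)
  qed
  then show "itin \<omega> = itin \<omega>'" by (rule agree_all_eq)
qed (simp add: K_def)

text \<open>A binary cylinder need not end at the end of a block: it is a cone cut down by a bounded
  number of further bits. Source type, target type, the map in \<open>E\<close> and these bits
  determine the local action, and each ranges over a finite set.\<close>

theorem rational_on_codes:
  assumes \<alpha>: "\<And>\<omega>. \<omega> \<in> Om \<Longrightarrow> \<alpha> \<omega> \<in> Om" and E: "finite E"
    and act: "\<And>\<omega> n. \<omega> \<in> Om \<Longrightarrow> \<exists>m e. e \<in> E \<and> n \<le> m + N \<and>
        (\<forall>\<omega>'\<in>cone \<omega> n. \<alpha> \<omega>' \<in> cone (\<alpha> \<omega>) m \<and> itin ((s ^^ m) (\<alpha> \<omega>')) = itin (e ((s ^^ n) \<omega>')))"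
    and inj: "\<And>\<omega> \<omega>'. \<omega> \<in> Om \<Longrightarrow> \<omega>' \<in> Om \<Longrightarrow> itin (\<alpha> \<omega>) = itin (\<alpha> \<omega>') \<Longrightarrow> itin \<omega> = itin \<omega>'"
  shows "\<exists>f. rational_fun f \<and> (\<forall>\<omega>\<in>Om. f (K \<omega>) = K (\<alpha> \<omega>))"
proof -
  let ?G = "(\<lambda>\<omega>. (K \<omega>, K (\<alpha> \<omega>))) ` Om"
  let ?Ty = "{cone_type \<omega> n |\<omega> n. \<omega> \<in> Om}"
  obtain M where M: "\<And>\<omega> n. \<omega> \<in> Om \<Longrightarrow> length (code Om (itin \<omega>) (Suc n)) \<le> length (code Om (itin \<omega>) n) + M"
    using block_bound by blast
  \<comment> \<open>\<open>P\<close> and \<open>Y\<close> are the source and target types, and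
    \<open>w\<close> holds the bits already read of the current, unfinished block.\<close>
  define loc where "loc = (\<lambda>(P, Y, e, w :: bool list).
      (\<lambda>x. (sdrop (length w) (code_lim P (itin x)), code_lim Y (itin (e x)))) ` {x \<in> P. pre w (code_lim P (itin x))})"
  let ?locs = "loc ` (?Ty \<times> ?Ty \<times> E \<times> {w :: bool list. length w \<le> M})"
  have "\<exists>f. rational_fun f \<and> (\<forall>a b. (a, b) \<in> ?G \<longrightarrow> f a = b)"
  proof (rule rational_extension[of ?G ?locs])
    show "\<exists>a b. (a, b) \<in> ?G \<and> agree n a \<psi>" for \<psi> n
      using K_dense[of n \<psi>] by blast
    show "finite ?locs"
      using finite_types E finite_lists_length_le[of "UNIV :: bool set" M] by simp
    show "a = a'" if ab: "(a, b) \<in> ?G" "(a', b) \<in> ?G" for a a' b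
    proof -
      obtain \<omega> \<omega>' where w: "\<omega> \<in> Om" "\<omega>' \<in> Om" "a = K \<omega>" "a' = K \<omega>'" "K (\<alpha> \<omega>) = K (\<alpha> \<omega>')"
        using ab by auto
      then have "itin \<omega> = itin \<omega>'" using inj[OF w(1,2)] K_eq_iff[OF \<alpha> \<alpha>, OF w(1,2)] by simp
      then show ?thesis using w K_eq_iff[OF w(1,2)] by simp
    qed
  next
    fix k
    obtain m where m: "\<And>\<omega> \<omega>'. \<omega> \<in> Om \<Longrightarrow> \<omega>' \<in> Om \<Longrightarrow> agree m (K \<omega>') (K \<omega>) \<Longrightarrow> \<omega>' \<in> cone \<omega> (k * gap + N)"
      using itin_agree_from_K by blast
    have "agree k (K (\<alpha> \<omega>')) (K (\<alpha> \<omega>))"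
      if w: "\<omega> \<in> Om" "\<omega>' \<in> Om" "agree m (K \<omega>') (K \<omega>)" for \<omega> \<omega>'
    proof -
      have c: "\<omega>' \<in> cone \<omega> (k * gap + N)" using m[OF w] .
      obtain j where j: "k * gap + N \<le> j + N" "\<alpha> \<omega>' \<in> cone (\<alpha> \<omega>) j"
        using act[OF w(1), of "k * gap + N"] c by blast
      then have "\<alpha> \<omega>' \<in> cone (\<alpha> \<omega>) (k * gap)"
        using agree_mono[of j "itin (\<alpha> \<omega>')" "itin (\<alpha> \<omega>)" "k * gap"] by (simp add: cone_def)
      then show ?thesis by (rule K_agree_from_itin[OF \<alpha>[OF w(1)]])
    qed
    then show "\<exists>n. \<forall>a b a' b'. (a, b) \<in> ?G \<longrightarrow> (a', b') \<in> ?G \<longrightarrow> agree n a a' \<longrightarrow> agree k b b'"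
      by (intro exI[of _ m]) auto
  next
    fix \<psi> n
    obtain \<omega> where w: "\<omega> \<in> Om" "agree n (K \<omega>) \<psi>" using K_dense by blast
    define c where "c j = length (code Om (itin \<omega>) j)" for j
    have c_ex: "\<exists>j. n < c j" using code_unbounded[OF w(1)] by (simp add: c_def)
    have c_0: "\<not> n < c 0" by (simp add: c_def)
    \<comment> \<open>The last block boundary at or before bit \<open>n\<close>. As blocks may be
      empty, it is found from the first boundary beyond \<open>n\<close>; the remaining
      \<open>r\<close> bits fit into one block.\<close>
    obtain j where j: "c j \<le> n" "n < c (Suc j)"
    proof -
      let ?j = "LEAST j. n < c j"
      have "n < c ?j" using c_ex by (rule LeastI_ex)
      moreover obtain i where "?j = Suc i"
        using c_0 \<open>n < c ?j\<close> by (cases ?j) simp_all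
      moreover have "\<not> n < c i" using calculation(2) by (intro not_less_Least) simp
      ultimately show ?thesis by (intro that[of i]) simp_all
    qed
    define r where "r = n - c j"
    have n: "n = c j + r" and r: "r \<le> M" using j M[OF w(1), of j] by (auto simp: r_def c_def)
    obtain m e where e: "e \<in> E" and me: "\<And>\<omega>'. \<omega>' \<in> cone \<omega> j \<Longrightarrow> \<alpha> \<omega>' \<in> cone (\<alpha> \<omega>) m"
      "\<And>\<omega>'. \<omega>' \<in> cone \<omega> j \<Longrightarrow> itin ((s ^^ m) (\<alpha> \<omega>')) = itin (e ((s ^^ j) \<omega>'))"
      using act[OF w(1)] by blast
    define u where "u = length (code Om (itin (\<alpha> \<omega>)) m)"
    let ?P = "cone_type \<omega> j" and ?Y = "cone_type (\<alpha> \<omega>) m"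
    define v where "v = map (sdrop (c j) \<psi>) [0..<r]"
    have v: "length v = r" "pre v \<phi> \<longleftrightarrow> agree r \<phi> (sdrop (c j) \<psi>)" for \<phi>
      by (auto simp: v_def pre_def agree_def)
    have pc: "pre (code Om (itin \<omega>) j) (K \<omega>)" by (simp add: K_def pre_code_lim)
    have agc: "agree (c j) (K \<omega>) \<psi>" by (rule agree_mono[OF w(2) j(1)])
    have in_cone: "agree (c j) (K \<omega>') \<psi> \<longleftrightarrow> \<omega>' \<in> cone \<omega> j" if "\<omega>' \<in> Om" for \<omega>'
    proof -
      have "agree (c j) (K \<omega>') \<psi> \<longleftrightarrow> agree (c j) (K \<omega>) (K \<omega>')"
        using agc by (auto simp: agree_def)
      also have "\<dots> \<longleftrightarrow> pre (code Om (itin \<omega>) j) (K \<omega>')"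
        using pc by (auto simp: c_def pre_def agree_def)
      finally show ?thesis using pre_code_K_iff[OF w(1) that] by simp
    qed
    have src: "sdrop (c j) (K \<omega>') = code_lim ?P (itin ((s ^^ j) \<omega>'))" if "\<omega>' \<in> cone \<omega> j" for \<omega>'
      using sdrop_K[OF cone_Om[OF that], of j] code_cong[OF cone_agree[OF that], of Om] cone_type_eq[OF that]
      by (simp add: c_def)
    have dst: "sdrop u (K (\<alpha> \<omega>')) = code_lim ?Y (itin (e ((s ^^ j) \<omega>')))" if "\<omega>' \<in> cone \<omega> j" for \<omega>'
      using sdrop_K[OF cone_Om[OF me(1)[OF that]], of m] code_cong[OF cone_agree[OF me(1)[OF that]], of Om]
        cone_type_eq[OF me(1)[OF that]] me(2)[OF that]
      by (simp add: u_def)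
    define D where "D = {\<omega>' \<in> cone \<omega> j. pre v (code_lim ?P (itin ((s ^^ j) \<omega>')))}"
    have D: "{\<omega>' \<in> Om. agree n (K \<omega>') \<psi>} = D"
    proof -
      have "agree n (K \<omega>') \<psi> \<longleftrightarrow> \<omega>' \<in> cone \<omega> j \<and> pre v (code_lim ?P (itin ((s ^^ j) \<omega>')))"
        if "\<omega>' \<in> Om" for \<omega>'
        using in_cone[OF that] src[of \<omega>'] unfolding n agree_add v(2) by auto
      then show ?thesis unfolding D_def using cone_Om by blast
    qed
    have cyl: "{(a, b) \<in> ?G. agree n a \<psi>} = (\<lambda>\<omega>. (K \<omega>, K (\<alpha> \<omega>))) ` D"
      unfolding D[symmetric] by auto
    have pre_u: "pre (code Om (itin (\<alpha> \<omega>)) m) (K (\<alpha> \<omega>'))" if "\<omega>' \<in> D" for \<omega>'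
    proof -
      have "\<alpha> \<omega>' \<in> cone (\<alpha> \<omega>) m" using me(1) that by (simp add: D_def)
      then show ?thesis using pre_code_K_iff[OF \<alpha>[OF w(1)]] cone_Om by blast
    qed
    have "(\<lambda>(a, b). (sdrop n a, sdrop u b)) ` {(a, b) \<in> ?G. agree n a \<psi>}
        = (\<lambda>\<omega>'. (sdrop r (code_lim ?P (itin ((s ^^ j) \<omega>'))), code_lim ?Y (itin (e ((s ^^ j) \<omega>'))))) ` D"
      unfolding cyl image_image
      by (rule image_cong[OF refl]) (auto simp: n sdrop_sdrop[symmetric] D_def src dst)
    also have "\<dots> = loc (?P, ?Y, e, v)"
    proof -
      have "{x \<in> ?P. pre v (code_lim ?P (itin x))} = (s ^^ j) ` D"
        unfolding D_def by (auto simp: cone_type_def)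
      then show ?thesis by (simp add: loc_def v(1) image_image)
    qed
    finally have "(\<lambda>(a, b). (sdrop n a, sdrop u b)) ` {(a, b) \<in> ?G. agree n a \<psi>} = loc (?P, ?Y, e, v)" .
    moreover have "loc (?P, ?Y, e, v) \<in> ?locs"
      using w(1) \<alpha> e v(1) r by (intro imageI) auto
    moreover have "\<forall>(a, b)\<in>{(a, b) \<in> ?G. agree n a \<psi>}. \<forall>(a', b')\<in>{(a, b) \<in> ?G. agree n a \<psi>}. agree u b b'"
      unfolding cyl using pre_imp_agree[OF pre_u pre_u] by (auto simp: u_def)
    ultimately show "\<exists>u. (\<forall>(a, b)\<in>{(a, b) \<in> ?G. agree n a \<psi>}. \<forall>(a', b')\<in>{(a, b) \<in> ?G. agree n a \<psi>}. agree u b b')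
        \<and> (\<lambda>(a, b). (sdrop n a, sdrop u b)) ` {(a, b) \<in> ?G. agree n a \<psi>} \<in> ?locs"
      by (intro exI[of _ u] conjI) simp_all
  qed
  then show ?thesis by blast
qed

end

section \<open>Word metrics and horofunctions\<close>

locale fg_group = group G for G (structure) +
  fixes S :: "'a set"
  assumes finite_S: "finite S" and S_carrier: "S \<subseteq> carrier G" and generate_S: "generate G S = carrier G"
begin

definition gens :: "'a set" where
  "gens = S \<union> (\<lambda>s. inv s) ` S"

definition word_prod :: "'a list \<Rightarrow> 'a" where
  "word_prod ws = foldr (\<lambda>x y. x \<otimes> y) ws \<one>"

abbreviation len :: "'a \<Rightarrow> nat" where
  "len \<equiv> word_len G S"

lemma len_def: "len g = (LEAST n. \<exists>ws. length ws = n \<and> set ws \<subseteq> gens \<and> word_prod ws = g)"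
  by (simp add: word_len_def gens_def word_prod_def)

lemma gens_carrier: "gens \<subseteq> carrier G"
  using S_carrier by (auto simp: gens_def)

lemma word_prod_simps [simp]: "word_prod [] = \<one>" "word_prod (a # ws) = a \<otimes> word_prod ws"
  by (simp_all add: word_prod_def)

lemma word_prod_closed: "set ws \<subseteq> gens \<Longrightarrow> word_prod ws \<in> carrier G"
  by (induction ws) (use gens_carrier in auto)

lemma word_prod_append:
  "set us \<subseteq> gens \<Longrightarrow> set vs \<subseteq> gens \<Longrightarrow> word_prod (us @ vs) = word_prod us \<otimes> word_prod vs"
proof (induction us)
  case (Cons a us)
  then have "a \<in> carrier G" "word_prod us \<in> carrier G" "word_prod vs \<in> carrier G"
    using gens_carrier word_prod_closed by auto
  then show ?case using Cons by (simp add: m_assoc)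
qed (simp add: word_prod_closed)

lemma gens_inv: "a \<in> gens \<Longrightarrow> inv a \<in> gens"
  using S_carrier by (auto simp: gens_def)

lemma word_prod_inv:
  "set ws \<subseteq> gens \<Longrightarrow> word_prod (rev (map (\<lambda>s. inv s) ws)) = inv (word_prod ws)"
proof (induction ws)
  case (Cons a ws)
  then have "a \<in> carrier G" "word_prod ws \<in> carrier G" using gens_carrier word_prod_closed by auto
  moreover have "set (rev (map (\<lambda>s. inv s) ws)) \<subseteq> gens" "set [inv a] \<subseteq> gens"
    using Cons.prems gens_inv by auto
  ultimately show ?case using Cons word_prod_append[of "rev (map (\<lambda>s. inv s) ws)" "[inv a]"]
    by (simp add: inv_mult_group)
qed simp

lemma word_ex: "g \<in> carrier G \<Longrightarrow> \<exists>ws. set ws \<subseteq> gens \<and> word_prod ws = g"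
proof -
  assume "g \<in> carrier G"
  then have "g \<in> generate G S" by (simp add: generate_S)
  then show ?thesis
  proof (induction rule: generate.induct)
    case one
    show ?case by (rule exI[of _ "[]"]) simp
  next
    case (incl h)
    then show ?case using S_carrier by (intro exI[of _ "[h]"]) (auto simp: gens_def)
  next
    case (inv h)
    then show ?case using S_carrier by (intro exI[of _ "[inv h]"]) (auto simp: gens_def)
  next
    case (eng h1 h2)
    then obtain us vs where "set us \<subseteq> gens" "word_prod us = h1" "set vs \<subseteq> gens" "word_prod vs = h2" by blast
    then show ?case by (intro exI[of _ "us @ vs"]) (simp add: word_prod_append)
  qed
qed

lemma len_le: "set ws \<subseteq> gens \<Longrightarrow> len (word_prod ws) \<le> length ws"
  unfolding len_def by (rule Least_le) blast

lemma len_word: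
  assumes "g \<in> carrier G"
  obtains ws where "length ws = len g" "set ws \<subseteq> gens" "word_prod ws = g"
proof -
  have "\<exists>n ws. length ws = n \<and> set ws \<subseteq> gens \<and> word_prod ws = g" using word_ex[OF assms] by blast
  then have "\<exists>ws. length ws = len g \<and> set ws \<subseteq> gens \<and> word_prod ws = g"
    unfolding len_def by (rule LeastI_ex)
  then show ?thesis using that by blast
qed

lemma len_one [simp]: "len \<one> = 0"
  using len_le[of "[]"] by simp

lemma len_eq_0: "g \<in> carrier G \<Longrightarrow> len g = 0 \<longleftrightarrow> g = \<one>"
  by (rule iffI) (erule len_word, auto)

lemma len_mult:
  assumes "g \<in> carrier G" "h \<in> carrier G"
  shows "len (g \<otimes> h) \<le> len g + len h"
proof -
  obtain us where us: "length us = len g" "set us \<subseteq> gens" "word_prod us = g" using len_word[OF assms(1)] .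
  obtain vs where vs: "length vs = len h" "set vs \<subseteq> gens" "word_prod vs = h" using len_word[OF assms(2)] .
  show ?thesis using len_le[of "us @ vs"] word_prod_append[of us vs] us vs by simp
qed

lemma len_inv_le:
  assumes "g \<in> carrier G"
  shows "len (inv g) \<le> len g"
proof -
  obtain us where us: "length us = len g" "set us \<subseteq> gens" "word_prod us = g" using len_word[OF assms] .
  have "set (rev (map (\<lambda>s. inv s) us)) \<subseteq> gens" using us gens_inv by auto
  then show ?thesis using len_le[of "rev (map (\<lambda>s. inv s) us)"] word_prod_inv[of us] us by simp
qed

lemma len_inv [simp]: "g \<in> carrier G \<Longrightarrow> len (inv g) = len g"
  using len_inv_le[of g] len_inv_le[of "inv g"] by simp

text \<open>Cutting a shortest word: if either piece could be shortened, so could the whole.\<close>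

lemma len_split:
  assumes g: "g \<in> carrier G" and k: "k \<le> len g"
  shows "\<exists>p\<in>carrier G. len p = k \<and> len (inv p \<otimes> g) = len g - k"
proof -
  obtain us where us: "length us = len g" "set us \<subseteq> gens" "word_prod us = g" using len_word[OF g] .
  let ?p = "word_prod (take k us)" and ?q = "word_prod (drop k us)"
  have sub: "set (take k us) \<subseteq> gens" "set (drop k us) \<subseteq> gens"
    using us set_take_subset[of k us] set_drop_subset[of k us] by auto
  then have c: "?p \<in> carrier G" "?q \<in> carrier G" by (simp_all add: word_prod_closed)
  have pq: "g = ?p \<otimes> ?q" using word_prod_append[OF sub] unfolding append_take_drop_id us(3) .
  have "inv ?p \<otimes> g = ?q" unfolding pq using c by (simp add: m_assoc[symmetric])
  moreover have "len ?p \<le> k" "len ?q \<le> len g - k"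
    using len_le[OF sub(1)] len_le[OF sub(2)] us k by simp_all
  moreover have "len g \<le> len ?p + len ?q" unfolding pq by (rule len_mult[OF c])
  ultimately show ?thesis using c k by (intro bexI[of _ ?p]) auto
qed

lemma finite_ball: "finite {g \<in> carrier G. len g \<le> n}"
proof (rule finite_subset)
  show "{g \<in> carrier G. len g \<le> n} \<subseteq> word_prod ` {ws. set ws \<subseteq> gens \<and> length ws \<le> n}"
  proof
    fix g assume "g \<in> {g \<in> carrier G. len g \<le> n}"
    then have g: "g \<in> carrier G" "len g \<le> n" by auto
    obtain ws where "length ws = len g" "set ws \<subseteq> gens" "word_prod ws = g" using len_word[OF g(1)] .
    then show "g \<in> word_prod ` {ws. set ws \<subseteq> gens \<and> length ws \<le> n}" using g by auto
  qed
  have "finite gens" using finite_S by (simp add: gens_def)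
  then show "finite (word_prod ` {ws. set ws \<subseteq> gens \<and> length ws \<le> n})"
    using finite_lists_length_le by blast
qed

text \<open>Integer-valued, so that horofunctions and Gromov products are not affected by truncated
  subtraction.\<close>

definition d :: "'a \<Rightarrow> 'a \<Rightarrow> int" where
  "d x y = int (len (inv x \<otimes> y))"

lemma d_nonneg [simp]: "0 \<le> d x y"
  by (simp add: d_def)

lemma d_one_left [simp]: "x \<in> carrier G \<Longrightarrow> d \<one> x = int (len x)"
  by (simp add: d_def)

lemma d_self [simp]: "x \<in> carrier G \<Longrightarrow> d x x = 0"
  by (simp add: d_def)

lemma d_sym: "x \<in> carrier G \<Longrightarrow> y \<in> carrier G \<Longrightarrow> d x y = d y x"
  using len_inv[of "inv x \<otimes> y"] by (simp add: d_def inv_mult_group)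

lemma d_one_right [simp]: "x \<in> carrier G \<Longrightarrow> d x \<one> = int (len x)"
  by (simp add: d_def)

lemma d_mult_left: "g \<in> carrier G \<Longrightarrow> x \<in> carrier G \<Longrightarrow> y \<in> carrier G \<Longrightarrow> d (g \<otimes> x) (g \<otimes> y) = d x y"
  by (simp add: d_def inv_mult_group m_assoc) (simp add: m_assoc[symmetric])

lemma d_shift: "x \<in> carrier G \<Longrightarrow> y \<in> carrier G \<Longrightarrow> z \<in> carrier G \<Longrightarrow> d (inv x \<otimes> y) z = d y (x \<otimes> z)"
  using d_mult_left[of x "inv x \<otimes> y" z] by (simp add: m_assoc[symmetric])

lemma d_triangle:
  assumes "x \<in> carrier G" "y \<in> carrier G" "z \<in> carrier G"
  shows "d x z \<le> d x y + d y z"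
proof -
  have "inv x \<otimes> z = (inv x \<otimes> y) \<otimes> (inv y \<otimes> z)"
    using assms by (simp add: m_assoc) (simp add: m_assoc[symmetric])
  then show ?thesis using len_mult[of "inv x \<otimes> y" "inv y \<otimes> z"] assms by (simp add: d_def)
qed

lemma d_eq_0: "x \<in> carrier G \<Longrightarrow> y \<in> carrier G \<Longrightarrow> d x y = 0 \<longleftrightarrow> x = y"
  using inv_solve_left[of \<one> x y] by (auto simp: d_def len_eq_0)

lemma geodesic:
  assumes "x \<in> carrier G" "y \<in> carrier G" "0 \<le> a" "a \<le> d x y"
  shows "\<exists>p\<in>carrier G. d x p = a \<and> d p y = d x y - a"
proof -
  have "nat a \<le> len (inv x \<otimes> y)" using assms(3,4) by (simp add: d_def)
  then obtain q where q: "q \<in> carrier G" "len q = nat a" "len (inv q \<otimes> (inv x \<otimes> y)) = len (inv x \<otimes> y) - nat a"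
    using len_split[of "inv x \<otimes> y" "nat a"] assms by auto
  have "d x (x \<otimes> q) = a" using q assms by (simp add: d_def m_assoc[symmetric])
  moreover have "d (x \<otimes> q) y = d x y - a"
    using q assms by (simp add: d_def inv_mult_group m_assoc)
  ultimately show ?thesis using q assms by blast
qed

text \<open>The horofunction of \<open>y\<close>, normalised at the identity and restricted to a ball.\<close>

definition sig :: "nat \<Rightarrow> 'a \<Rightarrow> 'a \<Rightarrow> int" where
  "sig r y = (\<lambda>b. if b \<in> carrier G \<and> len b \<le> r then d y b - d y \<one> else 0)"

text \<open>Horofunctions are 1-Lipschitz and vanish at the identity, so on the finite ball they
  take values between \<open>- r\<close> and \<open>r\<close>.\<close>

lemma finite_sig: "finite (sig r ` carrier G)"
proof (rule finite_subset)
  let ?B = "{b \<in> carrier G. len b \<le> r}"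
  let ?F = "{f. \<forall>x. (x \<in> ?B \<longrightarrow> f x \<in> {- int r..int r}) \<and> (x \<notin> ?B \<longrightarrow> f x = 0)}"
  show "finite ?F" by (rule finite_set_of_finite_funs) (simp_all add: finite_ball)
  have "sig r y b \<in> {- int r..int r}" if "y \<in> carrier G" "b \<in> ?B" for y b
    using that d_triangle[of y b \<one>] d_triangle[of y \<one> b] by (simp add: sig_def)
  then show "sig r ` carrier G \<subseteq> ?F" by (auto simp: sig_def)
qed

lemma sig_eq_near:
  assumes c: "x \<in> carrier G" "y \<in> carrier G" "y' \<in> carrier G" "z \<in> carrier G"
    and eq: "sig r (inv x \<otimes> y) = sig r (inv x \<otimes> y')" and z: "d x z \<le> int r"
  shows "d y z - d y x = d y' z - d y' x"
proof -
  have b: "inv x \<otimes> z \<in> carrier G" "len (inv x \<otimes> z) \<le> r" using c z by (simp_all add: d_def)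
  have "d (inv x \<otimes> w) (inv x \<otimes> z) = d w z" "d (inv x \<otimes> w) \<one> = d w x" if "w \<in> carrier G" for w
    using that c d_mult_left[of "inv x" w z] d_shift[of x w \<one>] by simp_all
  then show ?thesis using fun_cong[OF eq, of "inv x \<otimes> z"] b c by (simp add: sig_def)
qed

lemma sig_mono:
  assumes "sig r y = sig r y'" "q \<le> r"
  shows "sig q y = sig q y'"
proof
  show "sig q y b = sig q y' b" for b
    using fun_cong[OF assms(1), of b] assms(2) by (auto simp: sig_def split: if_splits)
qed

text \<open>The horofunction of \<open>y'\<close> descends to a neighbour of every point except \<open>y'\<close> itself.\<close>

lemma sig_inj_near:
  assumes c: "y \<in> carrier G" "y' \<in> carrier G" and eq: "sig r y = sig r y'" and y: "len y < r"
  shows "y = y'"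
proof (rule ccontr)
  assume ne: "y \<noteq> y'"
  then have "d y y' \<noteq> 0" using d_eq_0 c by blast
  then have "1 \<le> d y y'" using d_nonneg[of y y'] by linarith
  \<comment> \<open>One step from \<open>y\<close> towards \<open>y'\<close>. It still lies in the
    ball because \<open>len y < r\<close> is strict; there the horofunction of \<open>y'\<close>
    goes down while that of \<open>y\<close> goes up.\<close>
  then obtain p where p: "p \<in> carrier G" "d y p = 1" "d p y' = d y y' - 1"
    using geodesic[OF c, of 1] by auto
  have near: "d y z - d y \<one> = d y' z - d y' \<one>" if "z \<in> carrier G" "len z \<le> r" for z
    using fun_cong[OF eq, of z] that by (simp add: sig_def)
  have "len p \<le> len y + 1" using d_triangle[of \<one> y p] p c by simp
  then have "len p \<le> r" using y by simp
  then have "d y p - d y \<one> = d y' p - d y' \<one>" using near p by blast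
  moreover have "d y y - d y \<one> = d y' y - d y' \<one>" using near[of y] c y by simp
  ultimately show False using p c d_sym[of p y'] d_sym[of y y'] by simp
qed

text \<open>Arrival at the endpoint, that is a tail equal to the identity, can therefore be
  recognised from the letters.\<close>

lemma sig_one: "y \<in> carrier G \<Longrightarrow> 0 < r \<Longrightarrow> sig r y = sig r \<one> \<Longrightarrow> y = \<one>"
  using sig_inj_near[of \<one> y r] by auto

end

section \<open>Hyperbolicity and the extension of horofunctions beyond a ball\<close>

locale hyperbolic_fg_group = fg_group G S for G (structure) and S +
  fixes D :: nat
  assumes four_point: "\<lbrakk>x \<in> carrier G; y \<in> carrier G; z \<in> carrier G; w \<in> carrier G\<rbrakk>
      \<Longrightarrow> d x y + d z w \<le> max (d x z + d y w) (d y z + d x w) + int D"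
begin

text \<open>The Gromov product, doubled to stay within the integers.\<close>

definition gp :: "'a \<Rightarrow> 'a \<Rightarrow> 'a \<Rightarrow> int" where
  "gp x y w = d w x + d w y - d x y"

text \<open>Gromov's inequality with an upper bound on the left: a small product of \<open>x\<close>
  and \<open>y\<close> makes one of the products with \<open>z\<close> small. In use, one
  alternative is usually excluded, and the other survives at the cost of \<open>D\<close>.\<close>

lemma gp_ineq:
  assumes "x \<in> carrier G" "y \<in> carrier G" "z \<in> carrier G" "w \<in> carrier G" "gp x y w \<le> c"
  shows "gp x z w \<le> c + int D \<or> gp z y w \<le> c + int D"
  using four_point[of x y z w] assms d_sym[of y z] d_sym[of y w] d_sym[of x w] d_sym[of z w]
  unfolding gp_def by (auto simp: max_def split: if_splits)

lemma gp_sym: "x \<in> carrier G \<Longrightarrow> y \<in> carrier G \<Longrightarrow> gp x y w = gp y x w"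
  using d_sym[of x y] by (simp add: gp_def)

text \<open>\<open>p\<close> is the branch point of the comparison tripod on the side from
  \<open>z\<close> to \<open>y\<close>; the four-point condition bounds its distance from the
  identity. The summand 1 pays for halving an integer.\<close>

lemma close_point:
  assumes c: "y \<in> carrier G" "z \<in> carrier G" and gp: "gp z y \<one> \<le> k"
  shows "\<exists>p\<in>carrier G. d z p + d p y = d z y \<and> 2 * int (len p) \<le> k + 1 + 2 * int D"
proof -
  define a where "a = (int (len z) + d z y - int (len y)) div 2"
  have "0 \<le> a" "a \<le> d z y"
    using d_triangle[of \<one> z y] d_triangle[of z y \<one>] d_triangle[of \<one> y z] d_sym[of z y] c
    unfolding a_def by simp_all
  then obtain p where p: "p \<in> carrier G" "d z p = a" "d p y = d z y - a"
    using geodesic[of z y a] c by blast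
  have "d \<one> p + d z y \<le> max (d \<one> z + d p y) (d p z + d \<one> y) + int D"
    using four_point[of \<one> p z y] p c by simp
  moreover have "d p z = a" using p c d_sym by simp
  moreover have "2 * a \<le> int (len z) + d z y - int (len y)" "int (len z) + d z y - int (len y) \<le> 2 * a + 1"
    unfolding a_def by simp_all
  ultimately have "2 * int (len p) \<le> k + 1 + 2 * int D"
    using gp p c unfolding gp_def by (auto simp: max_def split: if_splits)
  moreover have "d z p + d p y = d z y" using p by simp
  ultimately show ?thesis using p(1) by blast
qed

text \<open>Large enough for two purposes in \<open>sig_extend_one\<close>:
  \<open>5 * D + 1 \<le> 2 * R\<close> keeps the branch points in the ball, and
  \<open>4 * D < 2 * R\<close> excludes an alternative of \<open>gp_ineq\<close>.\<close>

definition R :: nat where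
  "R = 3 * D + 1"

lemma R_pos: "0 < R"
  by (simp add: R_def)

text \<open>Geodesics from \<open>z\<close> to \<open>y\<close> and to \<open>y'\<close> can be
  chosen through points \<open>q\<close> and \<open>q'\<close> of the ball. There the two normalised
  horofunctions agree, so the detour to \<open>y\<close> via \<open>q'\<close> bounds one difference
  and the detour to \<open>y'\<close> via \<open>q\<close> the other.\<close>

lemma sig_extend_one:
  assumes c: "y \<in> carrier G" "y' \<in> carrier G" "z \<in> carrier G"
    and eq: "sig R y = sig R y'" and gp: "gp z y \<one> \<le> 2 * int D"
  shows "d y z - d y \<one> = d y' z - d y' \<one>"
proof (cases "len y < R")
  case True
  then show ?thesis using sig_inj_near[OF c(1,2) eq] by simp
next
  case False
  have near: "d y w - d y \<one> = d y' w - d y' \<one>" if "w \<in> carrier G" "len w \<le> R" for w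
    using fun_cong[OF eq, of w] that by (simp add: sig_def)
  obtain p where p: "p \<in> carrier G" "d \<one> p = int R" "d p y = d \<one> y - int R"
    using geodesic[of \<one> y "int R"] c False by auto
  have "d y p - d y \<one> = d y' p - d y' \<one>" using near p by simp
  then have "d p y' = int (len y') - int R" using p c d_sym[of p y] d_sym[of p y'] by simp
  then have "gp y p \<one> = 2 * int R" "gp p y' \<one> = 2 * int R"
    using p c d_sym[of y p] unfolding gp_def by simp_all
  \<comment> \<open>\<open>p\<close> lies on geodesics from the identity to both endpoints, at
    length \<open>R\<close>. The resulting bound \<open>5 * D + 2\<close> exceeds
    \<open>3 * D\<close>, so the small product of \<open>z\<close> and \<open>y\<close> passes to
    \<open>y'\<close>.\<close>
  then have yy': "2 * int R - int D \<le> gp y y' \<one>"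
    using gp_ineq[of y y' p \<one> "gp y y' \<one>"] c p by auto
  have gp': "gp z y' \<one> \<le> 3 * int D"
    using gp_ineq[of z y y' \<one> "2 * int D"] c gp yy' gp_sym[of y y' \<one>] by (auto simp: R_def)
  obtain q where q: "q \<in> carrier G" "d z q + d q y = d z y" "2 * int (len q) \<le> 2 * int D + 1 + 2 * int D"
    using close_point[OF c(1,3) gp] by blast
  obtain q' where q': "q' \<in> carrier G" "d z q' + d q' y' = d z y'" "2 * int (len q') \<le> 3 * int D + 1 + 2 * int D"
    using close_point[OF c(2,3) gp'] by blast
  have "len q \<le> R" "len q' \<le> R" using q q' unfolding R_def by linarith+
  then have "d y q - d y \<one> = d y' q - d y' \<one>" "d y q' - d y \<one> = d y' q' - d y' \<one>"
    using near q q' by blast+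
  moreover have "d z y \<le> d z q' + d q' y" "d z y' \<le> d z q + d q y'"
    using d_triangle c q q' by blast+
  ultimately show ?thesis
    using q q' c d_sym[of z y] d_sym[of z y'] d_sym[of q y] d_sym[of q y'] d_sym[of q' y] d_sym[of q' y']
    by linarith
qed

lemma gp_mult_left:
  "g \<in> carrier G \<Longrightarrow> x \<in> carrier G \<Longrightarrow> y \<in> carrier G \<Longrightarrow> w \<in> carrier G
   \<Longrightarrow> gp (g \<otimes> x) (g \<otimes> y) (g \<otimes> w) = gp x y w"
  by (simp add: gp_def d_mult_left)

lemma sig_extend:
  assumes c: "x \<in> carrier G" "y \<in> carrier G" "y' \<in> carrier G" "z \<in> carrier G"
    and eq: "sig R (inv x \<otimes> y) = sig R (inv x \<otimes> y')" and gp: "gp z y x \<le> 2 * int D"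
  shows "d y z - d y x = d y' z - d y' x"
proof -
  have "gp (inv x \<otimes> z) (inv x \<otimes> y) \<one> \<le> 2 * int D"
    using gp gp_mult_left[of "inv x" z y x] c by simp
  then have "d (inv x \<otimes> y) (inv x \<otimes> z) - d (inv x \<otimes> y) \<one> = d (inv x \<otimes> y') (inv x \<otimes> z) - d (inv x \<otimes> y') \<one>"
    using sig_extend_one[of "inv x \<otimes> y" "inv x \<otimes> y'" "inv x \<otimes> z"] c eq by simp
  then show ?thesis
    using c d_mult_left[of "inv x" _ z] d_shift[of x _ \<one>] by simp
qed

section \<open>Geodesics and cones\<close>

definition descent :: "'a \<Rightarrow> 'a" where
  "descent y = (SOME b. b \<in> carrier G \<and> len b = 1 \<and> sig R y b = - 1)"

text \<open>The identity is fixed, so iterates never leave the group and the attached bits can be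
  read after arrival.\<close>

definition advance_one :: "'a \<Rightarrow> 'a" where
  "advance_one y = (if y = \<one> then \<one> else inv (descent y) \<otimes> y)"

abbreviation tail :: "nat \<Rightarrow> 'a \<Rightarrow> 'a" where
  "tail n y \<equiv> (advance_one ^^ n) y"

text \<open>The \<open>n\<close>-th point of the chosen geodesic from the identity to \<open>y\<close>.\<close>

definition point :: "nat \<Rightarrow> 'a \<Rightarrow> 'a" where
  "point n y = y \<otimes> inv (tail n y)"

lemma descent:
  assumes "y \<in> carrier G" "y \<noteq> \<one>"
  shows descent_carrier: "descent y \<in> carrier G" and len_descent: "len (descent y) = 1"
    and d_descent: "d (descent y) y = int (len y) - 1"
proof -
  have "0 < len y" using assms len_eq_0 by auto
  then obtain p where p: "p \<in> carrier G" "d \<one> p = 1" "d p y = d \<one> y - 1"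
    using geodesic[of \<one> y 1] assms by auto
  then have "p \<in> carrier G \<and> len p = 1 \<and> sig R y p = - 1"
    using assms d_sym[of p y] R_pos by (simp add: sig_def)
  then have *: "descent y \<in> carrier G \<and> len (descent y) = 1 \<and> sig R y (descent y) = - 1"
    unfolding descent_def by (rule someI)
  then show "descent y \<in> carrier G" "len (descent y) = 1" by auto
  have "d y (descent y) - d y \<one> = - 1" using * R_pos by (auto simp: sig_def split: if_splits)
  then show "d (descent y) y = int (len y) - 1" using * assms d_sym[of "descent y" y] by simp
qed

lemma advance_one_closed [simp]: "y \<in> carrier G \<Longrightarrow> advance_one y \<in> carrier G"
  using descent_carrier by (simp add: advance_one_def)

lemma tail_closed [simp]: "y \<in> carrier G \<Longrightarrow> tail n y \<in> carrier G"
  by (induction n) auto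

lemma len_advance_one: "y \<in> carrier G \<Longrightarrow> len (advance_one y) = len y - 1"
  using d_descent[of y] by (auto simp: advance_one_def d_def)

lemma len_tail: "y \<in> carrier G \<Longrightarrow> len (tail n y) = len y - n"
  by (induction n) (auto simp: len_advance_one)

lemma tail_eq_one: "y \<in> carrier G \<Longrightarrow> tail n y = \<one> \<longleftrightarrow> len y \<le> n"
  using len_eq_0[of "tail n y"] by (simp add: len_tail)

lemma point_closed [simp]: "y \<in> carrier G \<Longrightarrow> point n y \<in> carrier G"
  by (simp add: point_def)

lemma point_0 [simp]: "y \<in> carrier G \<Longrightarrow> point 0 y = \<one>"
  by (simp add: point_def)

lemma point_Suc:
  assumes y: "y \<in> carrier G"
  shows "point (Suc n) y = (if tail n y = \<one> then point n y else point n y \<otimes> descent (tail n y))"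
  using y descent_carrier[of "tail n y"]
  by (simp add: point_def advance_one_def inv_mult_group m_assoc)

lemma tail_point: "y \<in> carrier G \<Longrightarrow> tail n y = inv (point n y) \<otimes> y"
  by (simp add: point_def inv_mult_group m_assoc)

lemma d_point_right: "y \<in> carrier G \<Longrightarrow> d (point n y) y = int (len y - n)"
  by (simp add: d_def tail_point[symmetric] len_tail)

lemma point_last: "y \<in> carrier G \<Longrightarrow> point (len y) y = y"
  using tail_eq_one[of y "len y"] by (simp add: point_def)

lemma d_point_step: "y \<in> carrier G \<Longrightarrow> d (point n y) (point (Suc n) y) \<le> 1"
  using descent_carrier[of "tail n y"] len_descent[of "tail n y"]
  by (simp add: point_Suc) (simp add: d_def m_assoc[symmetric])

lemma d_point_le: "y \<in> carrier G \<Longrightarrow> d (point k y) (point (k + j) y) \<le> int j"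
proof (induction j)
  case (Suc j)
  then show ?case
    using d_triangle[of "point k y" "point (k + j) y" "point (Suc (k + j)) y"] d_point_step[of y "k + j"]
    by simp
qed simp

lemma d_point:
  assumes y: "y \<in> carrier G" and kn: "k \<le> n" "n \<le> len y"
  shows "d (point k y) (point n y) = int (n - k)"
proof -
  have "d (point k y) (point n y) \<le> int (n - k)" using d_point_le[OF y, of k "n - k"] kn by simp
  moreover have "d (point k y) y \<le> d (point k y) (point n y) + d (point n y) y"
    using d_triangle y by simp
  ultimately show ?thesis using kn by (simp add: d_point_right y)
qed

lemma len_point: "y \<in> carrier G \<Longrightarrow> n \<le> len y \<Longrightarrow> len (point n y) = n"
  using d_point[of y 0 n] by simp

text \<open>\<open>descent\<close> depends on its argument only through \<open>sig R\<close>, and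
  arrival is visible by \<open>sig_one\<close>; so equal signatures give equal steps.\<close>

lemma point_cong:
  assumes c: "y \<in> carrier G" "y' \<in> carrier G"
    and eq: "\<forall>k<n. sig R (tail k y') = sig R (tail k y)"
  shows "point n y' = point n y"
  using eq
proof (induction n)
  case 0
  then show ?case using c by simp
next
  case (Suc n)
  then have s: "sig R (tail n y') = sig R (tail n y)" and p: "point n y' = point n y" by auto
  have "tail n y' = \<one> \<longleftrightarrow> tail n y = \<one>"
  proof
    assume "tail n y' = \<one>"
    then show "tail n y = \<one>" by (intro sig_one[OF _ R_pos]) (simp_all add: c s[symmetric])
  next
    assume "tail n y = \<one>"
    then show "tail n y' = \<one>" by (intro sig_one[OF _ R_pos]) (simp_all add: c s)
  qed
  moreover have "descent (tail n y') = descent (tail n y)" by (simp add: descent_def s)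
  ultimately show ?case using p c by (simp add: point_Suc)
qed

text \<open>Only balls around the points of the first geodesic are tested: by induction the second
  has followed the same points so far. The reference point \<open>q\<close> is free, since changing
  it alters both horofunctions by constants.\<close>

lemma sig_tail_eqI:
  assumes c: "y \<in> carrier G" "y' \<in> carrier G"
    and eq: "\<And>k b. k < n \<Longrightarrow> b \<in> carrier G \<Longrightarrow> len b \<le> R \<Longrightarrow>
        d y (point k y \<otimes> b) - d y q = d y' (point k y \<otimes> b) - d y' q"
  shows "\<forall>k<n. sig R (tail k y') = sig R (tail k y)"
  using eq
proof (induction n)
  case (Suc n)
  have IH: "\<forall>k<n. sig R (tail k y') = sig R (tail k y)"
    by (rule Suc.IH) (rule Suc.prems, auto)
  have p: "point n y' = point n y" by (rule point_cong[OF c IH])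
  have "sig R (tail n y') = sig R (tail n y)"
  proof
    fix b
    show "sig R (tail n y') b = sig R (tail n y) b"
    proof (cases "b \<in> carrier G \<and> len b \<le> R")
      case True
      have "d (tail n w) b - d (tail n w) \<one> = d w (point n y \<otimes> b) - d w (point n y)"
        if "w = y \<or> w = y'" for w
        using that c p True tail_point[of w n] d_shift[of "point n y" w b] d_shift[of "point n y" w \<one>] by auto
      moreover have "d y (point n y \<otimes> b) - d y (point n y) = d y' (point n y \<otimes> b) - d y' (point n y)"
        using Suc.prems[of n b] Suc.prems[of n \<one>] True c by simp
      ultimately show ?thesis using True by (simp add: sig_def)
    next
      case False
      then show ?thesis by (auto simp: sig_def)
    qed
  qed
  then show ?case using IH by (auto simp: less_Suc_eq)
qed simp

lemma sig_tail_imp_len: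
  assumes c: "y \<in> carrier G" "y' \<in> carrier G" and n: "n \<le> len y"
    and eq: "\<forall>k<n. sig R (tail k y') = sig R (tail k y)"
  shows "n \<le> len y'"
proof (cases n)
  case (Suc k)
  have "tail k y \<noteq> \<one>" using Suc n tail_eq_one[of y k] c by simp
  moreover have "sig R (tail k y') = sig R (tail k y)" using eq Suc by simp
  ultimately have "tail k y' \<noteq> \<one>" using sig_one[of "tail k y" R] R_pos c by auto
  then show ?thesis using tail_eq_one[of y' k] Suc c by simp
qed simp

text \<open>Hence a cone, translated to its base point, is a union of classes of equal \<open>sig (R + D)\<close>, and
  there are finitely many cone types.\<close>

lemma sig_saturated:
  assumes c: "y \<in> carrier G" "y' \<in> carrier G" and n: "n \<le> len y"
    and eq: "sig (R + D) (tail n y) = sig (R + D) (inv (point n y) \<otimes> y')"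
  shows "\<forall>k<n. sig R (tail k y') = sig R (tail k y)"
proof (rule sig_tail_eqI[OF c, where q = "point n y"])
  fix k b assume k: "k < n" and b: "b \<in> carrier G" "len b \<le> R"
  let ?x = "point n y" and ?p = "point k y"
  let ?z = "?p \<otimes> b"
  have eq': "sig (R + D) (inv ?x \<otimes> y) = sig (R + D) (inv ?x \<otimes> y')"
    using eq c by (simp add: tail_point)
  have cc: "?x \<in> carrier G" "?p \<in> carrier G" "?z \<in> carrier G" using c b by auto
  have dxp: "d ?x ?p = int (n - k)" using d_point[of y k n] d_sym[of ?x ?p] c k n by simp
  \<comment> \<open>The base point lies on a geodesic from \<open>?p\<close> to \<open>y\<close>.
    Hyperbolicity leaves two cases for \<open>?z\<close>: a small product with \<open>?p\<close>,
    which puts it within \<open>R + D\<close> of the base point, or one with \<open>y\<close>, which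
    allows \<open>sig_extend\<close>.\<close>
  have "gp ?p y ?x = 0"
    unfolding gp_def using c k n by (simp add: dxp d_point_right)
  then consider "gp ?p ?z ?x \<le> int D" | "gp ?z y ?x \<le> int D"
    using gp_ineq[of ?p y ?z ?x 0] c cc by auto
  then show "d y ?z - d y ?x = d y' ?z - d y' ?x"
  proof cases
    case 1
    have "d ?p ?z = int (len b)" using c b by (simp add: d_def m_assoc[symmetric])
    then have "d ?x ?z \<le> int (R + D)" using 1 b dxp unfolding gp_def by simp
    then show ?thesis using sig_eq_near[OF cc(1) c cc(3) eq'] by blast
  next
    case 2
    then show ?thesis
      using sig_extend[OF cc(1) c cc(3) sig_mono[OF eq', of R]] by simp
  qed
qed

text \<open>For \<open>k < n - lag g\<close>, a point within \<open>R\<close> of the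
  \<open>k\<close>-th point has length at most \<open>k + R\<close>, while the translated point
  number \<open>n - 1\<close> has length at least \<open>n - 1 - len g\<close>. The remaining gap
  exceeds the \<open>2 * D\<close> needed to exclude an alternative of
  \<open>gp_ineq\<close>.\<close>

definition lag :: "'a \<Rightarrow> nat" where
  "lag g = 2 * D + len g + R + 2"

text \<open>Beyond the lag, the geodesic from \<open>g\<close> to \<open>g y\<close> fellow travels the one from \<open>1\<close> to \<open>g y\<close>,
  so \<open>g\<close> maps cones into cones.\<close>

lemma sig_tail_translate:
  assumes c: "g \<in> carrier G" "y \<in> carrier G" "y' \<in> carrier G" and n: "n \<le> len y"
    and eq: "\<forall>k<n. sig R (tail k y') = sig R (tail k y)"
  shows "\<forall>k<n - lag g. sig R (tail k (g \<otimes> y')) = sig R (tail k (g \<otimes> y))"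
proof (cases "lag g < n")
  case False
  then show ?thesis by simp
next
  case True
  \<comment> \<open>The last point where equality of signatures is assumed; the signature at time
    \<open>n\<close> is not.\<close>
  let ?x = "point (n - 1) y"
  have gc: "g \<otimes> y \<in> carrier G" "g \<otimes> y' \<in> carrier G" "?x \<in> carrier G" "g \<otimes> ?x \<in> carrier G" using c by auto
  have px: "point (n - 1) y' = ?x" by (rule point_cong[OF c(2,3)]) (use eq in auto)
  have eqx: "sig R (inv ?x \<otimes> y) = sig R (inv ?x \<otimes> y')"
  proof -
    have "sig R (tail (n - 1) y) = sig R (tail (n - 1) y')" using eq True by auto
    then show ?thesis using px tail_point[OF c(2), of "n - 1"] tail_point[OF c(3), of "n - 1"] by simp
  qed
  have lenx: "len ?x = n - 1" using len_point[of y "n - 1"] c n by simp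
  have leny: "int (len (g \<otimes> y)) \<ge> int (len y) - int (len g)"
    using len_mult[of "inv g" "g \<otimes> y"] c by (simp add: m_assoc[symmetric])
  have lengx: "int (len (g \<otimes> ?x)) \<ge> int n - 1 - int (len g)"
    using len_mult[of "inv g" "g \<otimes> ?x"] c True lenx by (simp add: m_assoc[symmetric])
  have dgx: "d g (g \<otimes> ?x) = int n - 1"
    using c True lenx by (simp add: d_def m_assoc[symmetric])
  \<comment> \<open>\<open>g \<otimes> ?x\<close> is on a geodesic from \<open>g\<close> to
    \<open>g \<otimes> y\<close> and far from both \<open>g\<close> and the identity, so the zero
    product for \<open>g\<close> passes to the identity at the cost of one \<open>D\<close>.\<close>
  have "gp g (g \<otimes> y) (g \<otimes> ?x) = 0"
    using gp_mult_left[of g \<one> y ?x] c True n lenx d_point_right[of y "n - 1"]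
    by (simp add: gp_def)
  moreover have "int D < gp g \<one> (g \<otimes> ?x)"
    using lengx dgx c gc d_sym[of g "g \<otimes> ?x"] True by (simp add: gp_def lag_def)
  ultimately have g1: "gp \<one> (g \<otimes> y) (g \<otimes> ?x) \<le> int D"
    using gp_ineq[of g "g \<otimes> y" \<one> "g \<otimes> ?x" 0] c gc by simp
  show ?thesis
  proof (rule sig_tail_eqI[OF gc(1,2), where q = "g \<otimes> ?x"])
    fix k b assume k: "k < n - lag g" and b: "b \<in> carrier G" "len b \<le> R"
    let ?z = "point k (g \<otimes> y) \<otimes> b"
    have zc: "?z \<in> carrier G" "inv g \<otimes> ?z \<in> carrier G" using c gc b by auto
    have z: "?z = g \<otimes> (inv g \<otimes> ?z)" using c zc by (simp add: m_assoc[symmetric])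
    have "k \<le> len (g \<otimes> y)" using k n leny unfolding lag_def by linarith
    then have "int (len ?z) \<le> int k + int R"
      using len_mult[of "point k (g \<otimes> y)" b] len_point[of "g \<otimes> y" k] gc b by simp
    moreover have "int k + 2 * int D + int (len g) + int R + 2 < int n" using k unfolding lag_def by linarith
    ultimately have "2 * int D < d (g \<otimes> ?x) \<one> + d (g \<otimes> ?x) ?z - d \<one> ?z"
      using lengx d_nonneg[of "g \<otimes> ?x" ?z] d_one_left[OF zc(1)] d_one_right[OF gc(4)] by linarith
    then have "2 * int D < gp \<one> ?z (g \<otimes> ?x)" by (simp add: gp_def)
    \<comment> \<open>Passing from the identity to \<open>?z\<close> costs a second
      \<open>D\<close>, which reaches the tolerance of \<open>sig_extend\<close>.\<close>
    then have "gp ?z (g \<otimes> y) (g \<otimes> ?x) \<le> 2 * int D"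
      using gp_ineq[of \<one> "g \<otimes> y" ?z "g \<otimes> ?x" "int D"] g1 gc zc by simp
    then have "gp (inv g \<otimes> ?z) y ?x \<le> 2 * int D"
      using gp_mult_left[of g "inv g \<otimes> ?z" y ?x, folded z] c gc zc by simp
    then have "d y (inv g \<otimes> ?z) - d y ?x = d y' (inv g \<otimes> ?z) - d y' ?x"
      using sig_extend[OF gc(3) c(2,3) zc(2) eqx] by blast
    moreover have "d (g \<otimes> w) ?z = d w (inv g \<otimes> ?z)" "d (g \<otimes> w) (g \<otimes> ?x) = d w ?x" if "w \<in> carrier G" for w
      using d_mult_left[of g w "inv g \<otimes> ?z", folded z] d_mult_left[of g w ?x] c gc zc that by simp_all
    ultimately show "d (g \<otimes> y) ?z - d (g \<otimes> y) (g \<otimes> ?x) = d (g \<otimes> y') ?z - d (g \<otimes> y') (g \<otimes> ?x)"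
      using c by simp
  qed
qed

text \<open>Both points lie close to geodesics ending at \<open>g \<otimes> y\<close>, at nearly the
  same distance from that end; the four-point condition with the identity compares them. The bound
  leaves finitely many elements relating the two base points.\<close>

lemma point_translate_close:
  assumes c: "g \<in> carrier G" "y \<in> carrier G" and n: "n \<le> len y"
  shows "len (inv (point (n - lag g) (g \<otimes> y)) \<otimes> (g \<otimes> point n y)) \<le> len g + lag g + D"
proof (cases "lag g < n")
  case False
  have "len (g \<otimes> point n y) \<le> len g + n" using len_mult[of g "point n y"] len_point[of y n] c n by simp
  then show ?thesis using False c by simp
next
  case True
  let ?p = "point (n - lag g) (g \<otimes> y)" and ?q = "g \<otimes> point n y"
  have cc: "g \<otimes> y \<in> carrier G" "?p \<in> carrier G" "?q \<in> carrier G" using c by auto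
  have leny: "int (len (g \<otimes> y)) \<ge> int (len y) - int (len g)"
    using len_mult[of "inv g" "g \<otimes> y"] c by (simp add: m_assoc[symmetric])
  then have m: "n - lag g \<le> len (g \<otimes> y)" using n unfolding lag_def by linarith
  have p: "int (len ?p) = int n - int (lag g)" "d ?p (g \<otimes> y) = int (len (g \<otimes> y)) - int n + int (lag g)"
    using len_point[OF cc(1) m] d_point_right[OF cc(1), of "n - lag g"] m True by simp_all
  have q: "int (len ?q) \<le> int n + int (len g)" "d ?q (g \<otimes> y) = int (len y) - int n"
    using len_mult[of g "point n y"] len_point[of y n] d_mult_left[of g "point n y" y] d_point_right[of y n] c n
    by simp_all
  have "d ?p ?q + d \<one> (g \<otimes> y) \<le> max (d ?p \<one> + d ?q (g \<otimes> y)) (d ?q \<one> + d ?p (g \<otimes> y)) + int D"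
    by (rule four_point) (use cc in auto)
  then have "d ?p ?q \<le> int (len g) + int (lag g) + int D"
    using p q leny cc by (simp add: max_def split: if_splits)
  then show ?thesis by (simp add: d_def)
qed

section \<open>The action on the Cantor set\<close>

text \<open>Each element of the group carries a Cantor set, on which \<open>G\<close> acts trivially. This makes the
  space of itineraries perfect and the action faithful.\<close>

definition Om :: "('a \<times> (nat \<Rightarrow> bool)) set" where
  "Om = carrier G \<times> UNIV"

definition shift :: "'a \<times> (nat \<Rightarrow> bool) \<Rightarrow> 'a \<times> (nat \<Rightarrow> bool)" where
  "shift = (\<lambda>(y, c). (advance_one y, if y = \<one> then sdrop 1 c else c))"

text \<open>Before arrival the bit is held at \<open>False\<close> and \<open>c\<close> travels
  along unread.\<close>

definition letter :: "'a \<times> (nat \<Rightarrow> bool) \<Rightarrow> ('a \<Rightarrow> int) \<times> bool" where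
  "letter = (\<lambda>(y, c). (sig R y, y = \<one> \<and> c 0))"

definition translate :: "'a \<Rightarrow> 'a \<times> (nat \<Rightarrow> bool) \<Rightarrow> 'a \<times> (nat \<Rightarrow> bool)" where
  "translate g = (\<lambda>(y, c). (g \<otimes> y, c))"

lemma mem_Om [simp]: "(y, c) \<in> Om \<longleftrightarrow> y \<in> carrier G"
  by (simp add: Om_def)

lemma shift_Pair: "shift (y, c) = (advance_one y, if y = \<one> then sdrop 1 c else c)"
  by (simp add: shift_def)

lemma letter_Pair: "letter (y, c) = (sig R y, y = \<one> \<and> c 0)"
  by (simp add: letter_def)

lemma translate_Pair [simp]: "translate g (y, c) = (g \<otimes> y, c)"
  by (simp add: translate_def)

sublocale coding: shift_coding Om shift letter .

text \<open>The truncated difference \<open>n - len y\<close> counts the bits already consumed,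
  which is 0 until the identity has been reached.\<close>

lemma shift_iter: "y \<in> carrier G \<Longrightarrow> (shift ^^ n) (y, c) = (tail n y, sdrop (n - len y) c)"
proof (induction n)
  case (Suc n)
  then show ?case
    using tail_eq_one[of y n] by (auto simp: shift_Pair sdrop_sdrop Suc_diff_le)
qed simp

lemma itin_eq: "y \<in> carrier G \<Longrightarrow> coding.itin (y, c) n = (sig R (tail n y), len y \<le> n \<and> c (n - len y))"
  using tail_eq_one[of y n] by (simp add: coding.itin_def shift_iter letter_Pair sdrop_def)

text \<open>The letters with index below \<open>n \<le> len y\<close> stop short of arrival, so they
  leave \<open>c'\<close> unconstrained; equal signatures also prevent \<open>y'\<close> from
  arriving earlier.\<close>

lemma cone_before:
  assumes y: "y \<in> carrier G" and n: "n \<le> len y"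
  shows "(y', c') \<in> coding.cone (y, c) n \<longleftrightarrow>
    y' \<in> carrier G \<and> (\<forall>k<n. sig R (tail k y') = sig R (tail k y))"
proof (cases "y' \<in> carrier G \<and> (\<forall>k<n. sig R (tail k y') = sig R (tail k y))")
  case True
  then have "n \<le> len y'" using sig_tail_imp_len[OF y _ n] by blast
  then show ?thesis using True n y by (simp add: coding.cone_def agree_def itin_eq)
next
  case False
  then show ?thesis using y by (auto simp: coding.cone_def agree_def itin_eq)
qed

text \<open>The letter with index \<open>len y\<close> announces arrival, so \<open>y'\<close> has
  ended at the same point and only the bits read since then remain to be compared.\<close>

lemma cone_after:
  assumes y: "y \<in> carrier G" and n: "len y < n"
  shows "(y', c') \<in> coding.cone (y, c) n \<longleftrightarrow> y' = y \<and> agree (n - len y) c' c"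
proof
  assume "(y', c') \<in> coding.cone (y, c) n"
  then have y': "y' \<in> carrier G" and eq: "\<And>k. k < n \<Longrightarrow> coding.itin (y', c') k = coding.itin (y, c) k"
    by (auto simp: coding.cone_def agree_def)
  have s: "sig R (tail k y') = sig R (tail k y)" if "k < n" for k
    using eq[OF that] y y' by (simp add: itin_eq)
  have "tail (len y) y = \<one>" using tail_eq_one[OF y] by simp
  then have "tail (len y) y' = \<one>" using s[OF n] y' by (intro sig_one[OF _ R_pos]) simp_all
  then have "point (len y) y' = y'" using y' by (simp add: point_def)
  moreover have "point (len y) y' = point (len y) y" by (rule point_cong[OF y y']) (use s n in simp)
  ultimately have yy: "y' = y" using point_last[OF y] by simp
  have "c' i = c i" if "i < n - len y" for i
    using eq[of "len y + i"] that y yy by (simp add: itin_eq)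
  then show "y' = y \<and> agree (n - len y) c' c" using yy by (simp add: agree_def)
next
  assume *: "y' = y \<and> agree (n - len y) c' c"
  have "c' (k - len y) = c (k - len y)" if "len y \<le> k" "k < n" for k
    using * that by (simp add: agree_def diff_less_mono)
  then have "agree n (coding.itin (y, c')) (coding.itin (y, c))"
    using y by (auto simp: agree_def itin_eq)
  then show "(y', c') \<in> coding.cone (y, c) n" using * y by (simp add: coding.cone_def)
qed

lemma cone_type_form:
  assumes y: "y \<in> carrier G"
  shows "\<exists>V \<subseteq> sig (R + D) ` carrier G. coding.cone_type (y, c) n = {w \<in> carrier G. sig (R + D) w \<in> V} \<times> UNIV"
proof (cases "n \<le> len y")
  case True
  let ?x = "point n y"
  let ?A = "{w \<in> carrier G. \<forall>k<n. sig R (tail k (?x \<otimes> w)) = sig R (tail k y)}"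
  have "coding.cone_type (y, c) n = ?A \<times> UNIV"
  proof (intro equalityI subsetI)
    fix p assume "p \<in> coding.cone_type (y, c) n"
    then obtain y' c' where y': "(y', c') \<in> coding.cone (y, c) n" "p = (shift ^^ n) (y', c')"
      unfolding coding.cone_type_def by auto
    then have c: "y' \<in> carrier G" and s: "\<forall>k<n. sig R (tail k y') = sig R (tail k y)"
      using cone_before[OF y True] by auto
    have "tail n y' = inv ?x \<otimes> y'" using tail_point[OF c] point_cong[OF y c s] by simp
    moreover have "?x \<otimes> (inv ?x \<otimes> y') = y'" using c y by (simp add: m_assoc[symmetric])
    ultimately show "p \<in> ?A \<times> UNIV" using y'(2) c y s by (simp add: shift_iter)
  next
    fix p assume "p \<in> ?A \<times> (UNIV :: (nat \<Rightarrow> bool) set)"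
    then obtain w c' where w: "w \<in> ?A" "p = (w, c')" by auto
    let ?y = "?x \<otimes> w"
    have c: "?y \<in> carrier G" using w y by simp
    have s: "\<forall>k<n. sig R (tail k ?y) = sig R (tail k y)" using w by simp
    have "n \<le> len ?y" by (rule sig_tail_imp_len[OF y c True s])
    moreover have "tail n ?y = w"
      using tail_point[OF c, of n] point_cong[OF y c s] w y by (simp add: m_assoc[symmetric])
    ultimately have "p = (shift ^^ n) (?y, c')" using w(2) by (simp add: shift_iter[OF c])
    moreover have "(?y, c') \<in> coding.cone (y, c) n" using cone_before[OF y True] c s by simp
    ultimately show "p \<in> coding.cone_type (y, c) n" unfolding coding.cone_type_def by (rule image_eqI)
  qed
  \<comment> \<open>By \<open>sig_saturated\<close>, membership depends only on
    \<open>sig (R + D)\<close>. Thus \<open>?A\<close> is recovered from its image in a finite set,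
    and that image serves as \<open>V\<close>.\<close>
  moreover have "?A = {w \<in> carrier G. sig (R + D) w \<in> sig (R + D) ` ?A}"
  proof (intro equalityI subsetI)
    fix w assume "w \<in> {w \<in> carrier G. sig (R + D) w \<in> sig (R + D) ` ?A}"
    then obtain w' where w: "w \<in> carrier G" and w': "w' \<in> ?A" and eq: "sig (R + D) w = sig (R + D) w'" by auto
    let ?y = "?x \<otimes> w" and ?y' = "?x \<otimes> w'"
    have c: "?y \<in> carrier G" "?y' \<in> carrier G" using w w' y by auto
    have s': "\<forall>k<n. sig R (tail k ?y') = sig R (tail k y)" using w' by simp
    have n': "n \<le> len ?y'" by (rule sig_tail_imp_len[OF y c(2) True s'])
    have px: "point n ?y' = ?x" by (rule point_cong[OF y c(2) s'])
    have "tail n ?y' = w'" "inv ?x \<otimes> ?y = w"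
      using tail_point[OF c(2), of n] px w w' y by (simp_all add: m_assoc[symmetric])
    then have "\<forall>k<n. sig R (tail k ?y) = sig R (tail k ?y')"
      using sig_saturated[OF c(2,1) n'] eq px by simp
    then show "w \<in> ?A" using s' w by simp
  qed auto
  ultimately show ?thesis
    by (intro exI[of _ "sig (R + D) ` ?A"]) auto
next
  case False
  then have n: "len y < n" by simp
  have "coding.cone_type (y, c) n = {\<one>} \<times> UNIV"
  proof (intro equalityI subsetI)
    fix p assume "p \<in> coding.cone_type (y, c) n"
    then obtain y' c' where y': "(y', c') \<in> coding.cone (y, c) n" "p = (shift ^^ n) (y', c')"
      unfolding coding.cone_type_def by auto
    then have "y' = y" using cone_after[OF y n] by simp
    then show "p \<in> {\<one>} \<times> UNIV" using y'(2) y n tail_eq_one[OF y, of n] by (simp add: shift_iter)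
  next
    fix p assume "p \<in> {\<one>} \<times> (UNIV :: (nat \<Rightarrow> bool) set)"
    then obtain c' where p: "p = (\<one>, c')" by auto
    \<comment> \<open>The consumed bits of \<open>c\<close> are put in front of \<open>c'\<close>,
      so that the shift returns \<open>c'\<close>.\<close>
    let ?c = "\<lambda>i. if i < n - len y then c i else c' (i - (n - len y))"
    have c: "(y, ?c) \<in> coding.cone (y, c) n" using cone_after[OF y n] by (simp add: agree_def)
    have "tail n y = \<one>" using tail_eq_one[OF y, of n] n by simp
    moreover have "sdrop (n - len y) ?c = c'" by (rule ext) (simp add: sdrop_def)
    ultimately have "p = (shift ^^ n) (y, ?c)" using y by (simp add: shift_iter p)
    then show "p \<in> coding.cone_type (y, c) n" unfolding coding.cone_type_def using c by (rule image_eqI)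
  qed
  moreover have "{\<one>} = {w \<in> carrier G. sig (R + D) w \<in> {sig (R + D) \<one>}}"
    using sig_one[of _ "R + D"] R_pos by auto
  ultimately show ?thesis by (intro exI[of _ "{sig (R + D) \<one>}"]) auto
qed

lemma shift_closed: "p \<in> Om \<Longrightarrow> shift p \<in> Om"
  by (auto simp: Om_def shift_def)

sublocale coding: perfect_shift_coding Om shift letter
proof
  show "Om \<noteq> {}" by (auto simp: Om_def)
  show "shift p \<in> Om" if "p \<in> Om" for p using that by (rule shift_closed)
  have "letter ` Om \<subseteq> sig R ` carrier G \<times> UNIV" by (auto simp: letter_def Om_def)
  then show "finite (letter ` Om)" by (rule finite_subset) (simp add: finite_sig)
  have "{coding.cone_type p n |p n. p \<in> Om}
      \<subseteq> (\<lambda>V. {w \<in> carrier G. sig (R + D) w \<in> V} \<times> UNIV) ` Pow (sig (R + D) ` carrier G)"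
  proof clarify
    fix y c n assume "(y, c) \<in> Om"
    then have "y \<in> carrier G" by (simp add: Om_def)
    from cone_type_form[OF this, of c n]
    show "coding.cone_type (y, c) n
      \<in> (\<lambda>V. {w \<in> carrier G. sig (R + D) w \<in> V} \<times> UNIV) ` Pow (sig (R + D) ` carrier G)" by auto
  qed
  then show "finite {coding.cone_type p n |p n. p \<in> Om}"
    by (rule finite_subset) (simp add: finite_sig)
next
  fix p n assume "p \<in> Om"
  then obtain y c where p: "p = (y, c)" "y \<in> carrier G" by (auto simp: Om_def)
  \<comment> \<open>Bit \<open>n\<close> is read at time \<open>len y + n\<close>, so flipping it
    leaves the first \<open>n\<close> letters unchanged.\<close>
  let ?c = "c(n := \<not> c n)"
  have "agree n (coding.itin (y, ?c)) (coding.itin (y, c))"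
    using p by (auto simp: agree_def itin_eq)
  moreover have "coding.itin (y, ?c) (len y + n) \<noteq> coding.itin (y, c) (len y + n)"
    using p by (simp add: itin_eq)
  ultimately show "\<exists>p'\<in>coding.cone p n. coding.itin p' \<noteq> coding.itin p"
    using p by (intro bexI[of _ "(y, ?c)"]) (auto simp: coding.cone_def)
qed

section \<open>Left translation on cones and itineraries\<close>

lemma translate_closed: "g \<in> carrier G \<Longrightarrow> p \<in> Om \<Longrightarrow> translate g p \<in> Om"
  by (auto simp: Om_def)

lemma translate_mult:
  "g \<in> carrier G \<Longrightarrow> h \<in> carrier G \<Longrightarrow> p \<in> Om \<Longrightarrow> translate (g \<otimes> h) p = translate g (translate h p)"
  by (auto simp: Om_def m_assoc)

lemma translate_one: "p \<in> Om \<Longrightarrow> translate \<one> p = p"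
  by (auto simp: Om_def)

text \<open>Up to the endpoint, both tails are the endpoint seen from base points that do not vary
  within the cone, so they differ by one fixed translation. After arrival both tails are the
  identity.\<close>

lemma translate_cone:
  assumes g: "g \<in> carrier G" and p: "p \<in> Om"
  shows "\<exists>m e. e \<in> translate ` {e \<in> carrier G. len e \<le> len g + lag g + D} \<and> n \<le> m + lag g \<and>
    (\<forall>p'\<in>coding.cone p n. translate g p' \<in> coding.cone (translate g p) m
      \<and> (shift ^^ m) (translate g p') = e ((shift ^^ n) p'))"
proof -
  obtain y c where yc: "p = (y, c)" "y \<in> carrier G" using p by (auto simp: Om_def)
  note y = yc(2)
  have gy: "g \<otimes> y \<in> carrier G" using g y by simp
  have leny: "len y \<le> len (g \<otimes> y) + len g"
    using len_mult[of "inv g" "g \<otimes> y"] g y by (simp add: m_assoc[symmetric])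
  show ?thesis
  proof (cases "n \<le> len y")
    case True
    let ?m = "n - lag g"
    let ?e = "inv (point ?m (g \<otimes> y)) \<otimes> (g \<otimes> point n y)"
    have e: "?e \<in> carrier G" using g y by simp
    have "translate g p' \<in> coding.cone (translate g p) ?m
        \<and> (shift ^^ ?m) (translate g p') = translate ?e ((shift ^^ n) p')" if "p' \<in> coding.cone p n" for p'
    proof -
      obtain y' c' where p': "p' = (y', c')" by (cases p')
      then have c: "y' \<in> carrier G" and s: "\<forall>k<n. sig R (tail k y') = sig R (tail k y)"
        using that cone_before[OF y True] yc by auto
      have gy': "g \<otimes> y' \<in> carrier G" using g c by simp
      have m: "?m \<le> len (g \<otimes> y)" using True leny unfolding lag_def by linarith
      have s': "\<forall>k<?m. sig R (tail k (g \<otimes> y')) = sig R (tail k (g \<otimes> y))"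
        by (rule sig_tail_translate[OF g y c True s])
      have n': "n \<le> len y'" by (rule sig_tail_imp_len[OF y c True s])
      have m': "?m \<le> len (g \<otimes> y')" by (rule sig_tail_imp_len[OF gy gy' m s'])
      have "tail ?m (g \<otimes> y') = inv (point ?m (g \<otimes> y)) \<otimes> (g \<otimes> y')"
        using tail_point[OF gy'] point_cong[OF gy gy' s'] by simp
      moreover have "tail n y' = inv (point n y) \<otimes> y'"
        using tail_point[OF c] point_cong[OF y c s] by simp
      moreover have "?e \<otimes> (inv (point n y) \<otimes> y') = inv (point ?m (g \<otimes> y)) \<otimes> (g \<otimes> y')"
      proof -
        have "?e \<otimes> (inv (point n y) \<otimes> y') = inv (point ?m (g \<otimes> y)) \<otimes> (g \<otimes> (point n y \<otimes> (inv (point n y) \<otimes> y')))"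
          using g y c by (simp add: m_assoc)
        also have "point n y \<otimes> (inv (point n y) \<otimes> y') = y'"
          using y c by (simp add: m_assoc[symmetric])
        finally show ?thesis .
      qed
      ultimately have "(shift ^^ ?m) (translate g p') = translate ?e ((shift ^^ n) p')"
        using n' m' by (simp add: p' shift_iter[OF c] shift_iter[OF gy'])
      moreover have "translate g p' \<in> coding.cone (translate g p) ?m"
        using cone_before[OF gy m] gy' s' by (simp add: p' yc)
      ultimately show ?thesis by blast
    qed
    moreover have "len ?e \<le> len g + lag g + D" by (rule point_translate_close[OF g y True])
    ultimately show ?thesis using e by (intro exI[of _ ?m] exI[of _ "translate ?e"]) auto
  next
    case False
    then have n: "len y < n" by simp
    \<comment> \<open>Times are matched so that the same number of bits has been read before and
      after translation.\<close>
    let ?m = "n - len y + len (g \<otimes> y)"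
    have m: "len (g \<otimes> y) < ?m" using n by simp
    have "translate g p' \<in> coding.cone (translate g p) ?m
        \<and> (shift ^^ ?m) (translate g p') = translate \<one> ((shift ^^ n) p')" if *: "p' \<in> coding.cone p n" for p'
    proof -
      obtain c' where p': "p' = (y, c')" "agree (n - len y) c' c"
        using * cone_after[OF y n] yc by (cases p') auto
      have "tail ?m (g \<otimes> y) = \<one>" "tail n y = \<one>" using tail_eq_one gy y n by simp_all
      then have "(shift ^^ ?m) (translate g p') = translate \<one> ((shift ^^ n) p')"
        by (simp add: p'(1) shift_iter[OF y] shift_iter[OF gy])
      moreover have "translate g p' \<in> coding.cone (translate g p) ?m"
        using cone_after[OF gy m] p' by (simp add: yc)
      ultimately show ?thesis by blast
    qed
    moreover have "n \<le> ?m + lag g" using n leny unfolding lag_def by linarith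
    ultimately show ?thesis by (intro exI[of _ ?m] exI[of _ "translate \<one>"]) auto
  qed
qed

text \<open>Equal itineraries mean lying in common cones of every depth, and translation reduces
  depth by at most \<open>lag g\<close>.\<close>

lemma translate_itin_cong:
  assumes g: "g \<in> carrier G" and p: "p \<in> Om" "p' \<in> Om" and eq: "coding.itin p = coding.itin p'"
  shows "coding.itin (translate g p) = coding.itin (translate g p')"
proof (rule agree_all_eq)
  fix k
  have "p \<in> coding.cone p' (k + lag g)" using p eq by (simp add: coding.cone_def)
  moreover obtain m e where "k + lag g \<le> m + lag g"
    "\<forall>q\<in>coding.cone p' (k + lag g). translate g q \<in> coding.cone (translate g p') m
      \<and> (shift ^^ m) (translate g q) = e ((shift ^^ (k + lag g)) q)"
    using translate_cone[OF g p(2), of "k + lag g"] by blast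
  ultimately have "translate g p \<in> coding.cone (translate g p') m" "k \<le> m" by auto
  then show "agree k (coding.itin (translate g p)) (coding.itin (translate g p'))"
    using coding.cone_agree agree_mono by blast
qed

lemma translate_itin_inj:
  assumes g: "g \<in> carrier G" and p: "p \<in> Om" "p' \<in> Om"
    and eq: "coding.itin (translate g p) = coding.itin (translate g p')"
  shows "coding.itin p = coding.itin p'"
  using translate_itin_cong[OF inv_closed[OF g] translate_closed[OF g p(1)] translate_closed[OF g p(2)] eq]
    translate_mult[of "inv g" g] g p by (simp add: translate_one)

lemma rational_translate:
  assumes g: "g \<in> carrier G"
  shows "\<exists>f. rational_fun f \<and> (\<forall>p\<in>Om. f (coding.K p) = coding.K (translate g p))"
proof (rule coding.rational_on_codes)
  show "finite (translate ` {e \<in> carrier G. len e \<le> len g + lag g + D})" by (simp add: finite_ball)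
  show "translate g p \<in> Om" if "p \<in> Om" for p using translate_closed[OF g that] .
  show "coding.itin p = coding.itin p'"
    if "p \<in> Om" "p' \<in> Om" "coding.itin (translate g p) = coding.itin (translate g p')" for p p'
    using translate_itin_inj[OF g that] .
  show "\<exists>m e. e \<in> translate ` {e \<in> carrier G. len e \<le> len g + lag g + D} \<and> n \<le> m + lag g \<and>
        (\<forall>p'\<in>coding.cone p n. translate g p' \<in> coding.cone (translate g p) m
          \<and> coding.itin ((shift ^^ m) (translate g p')) = coding.itin (e ((shift ^^ n) p')))"
    if p: "p \<in> Om" for p n
  proof -
    obtain m e where "e \<in> translate ` {e \<in> carrier G. len e \<le> len g + lag g + D}" "n \<le> m + lag g"
      and me: "\<forall>p'\<in>coding.cone p n. translate g p' \<in> coding.cone (translate g p) m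
        \<and> (shift ^^ m) (translate g p') = e ((shift ^^ n) p')"
      using translate_cone[OF g p, of n] by blast
    then show ?thesis by (intro exI[of _ m] exI[of _ e]) simp
  qed
qed

section \<open>The faithful action by rational homeomorphisms\<close>

definition act :: "'a \<Rightarrow> (nat \<Rightarrow> bool) \<Rightarrow> nat \<Rightarrow> bool" where
  "act g = (SOME f. rational_fun f \<and> (\<forall>p\<in>Om. f (coding.K p) = coding.K (translate g p)))"

lemma act:
  assumes "g \<in> carrier G"
  shows rational_act: "rational_fun (act g)" and act_K: "p \<in> Om \<Longrightarrow> act g (coding.K p) = coding.K (translate g p)"
  using someI_ex[OF rational_translate[OF assms]] unfolding act_def[symmetric] by simp_all

text \<open>Density of the codes makes the extension chosen in \<open>act\<close> unique; the group
  laws are therefore checked on codes only.\<close>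

lemma eq_on_codes:
  fixes f h :: "(nat \<Rightarrow> bool) \<Rightarrow> nat \<Rightarrow> bool"
  assumes cont: "\<And>\<psi> k. \<exists>n. \<forall>\<phi>. agree n \<psi> \<phi> \<longrightarrow> f \<phi> k = f \<psi> k" "\<And>\<psi> k. \<exists>n. \<forall>\<phi>. agree n \<psi> \<phi> \<longrightarrow> h \<phi> k = h \<psi> k"
    and eq: "\<And>p. p \<in> Om \<Longrightarrow> f (coding.K p) = h (coding.K p)"
  shows "f = h"
proof (rule eq_on_dense[of f h "coding.K ` Om"])
  show "\<exists>n. \<forall>\<phi>. agree n \<psi> \<phi> \<longrightarrow> f \<phi> k = f \<psi> k" for \<psi> k by (rule cont(1))
  show "\<exists>n. \<forall>\<phi>. agree n \<psi> \<phi> \<longrightarrow> h \<phi> k = h \<psi> k" for \<psi> k by (rule cont(2))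
  show "\<exists>a\<in>coding.K ` Om. agree n \<psi> a" for \<psi> n
    using coding.K_dense[of n \<psi>] agree_sym by blast
  show "f a = h a" if "a \<in> coding.K ` Om" for a using that eq by blast
qed

lemma act_mult:
  assumes g: "g \<in> carrier G" and h: "h \<in> carrier G"
  shows "act (g \<otimes> h) = act g \<circ> act h"
proof (rule eq_on_codes)
  show "\<exists>n. \<forall>\<phi>. agree n \<psi> \<phi> \<longrightarrow> act (g \<otimes> h) \<phi> k = act (g \<otimes> h) \<psi> k" for \<psi> k
    by (rule rational_fun_cont[OF rational_act[OF m_closed[OF g h]]])
  show "\<exists>n. \<forall>\<phi>. agree n \<psi> \<phi> \<longrightarrow> (act g \<circ> act h) \<phi> k = (act g \<circ> act h) \<psi> k" for \<psi> k
    using cont_comp[OF rational_fun_cont[OF rational_act[OF g]] rational_fun_cont[OF rational_act[OF h]]] by simp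
  show "act (g \<otimes> h) (coding.K p) = (act g \<circ> act h) (coding.K p)" if "p \<in> Om" for p
    using that g h by (simp add: act_K translate_closed translate_mult)
qed

lemma act_one: "act \<one> = id"
proof (rule eq_on_codes)
  show "\<exists>n. \<forall>\<phi>. agree n \<psi> \<phi> \<longrightarrow> act \<one> \<phi> k = act \<one> \<psi> k" for \<psi> k
    by (rule rational_fun_cont[OF rational_act[OF one_closed]])
  show "\<exists>n. \<forall>\<phi>. agree n \<psi> \<phi> \<longrightarrow> id \<phi> k = id \<psi> k" for \<psi> :: "nat \<Rightarrow> bool" and k
    by (rule exI[of _ "Suc k"]) (simp add: agree_def)
qed (simp add: act_K translate_one)

lemma act_inj:
  assumes g: "g \<in> carrier G" and h: "h \<in> carrier G" and eq: "act g = act h"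
  shows "g = h"
proof -
  \<comment> \<open>The first letter already distinguishes these two points unless
    \<open>inv h \<otimes> g\<close> is the identity.\<close>
  let ?p = "(\<one>, \<lambda>_. False) :: 'a \<times> (nat \<Rightarrow> bool)" and ?q = "(inv h \<otimes> g, \<lambda>_. False) :: 'a \<times> (nat \<Rightarrow> bool)"
  have p: "?p \<in> Om" "?q \<in> Om" using g h by (auto simp: Om_def)
  have "act (inv h \<otimes> g) = act (inv h \<otimes> h)"
    using g h eq by (simp only: act_mult inv_closed)
  then have "act (inv h \<otimes> g) = id" using h by (simp add: act_one)
  then have "coding.K ?q = coding.K ?p"
    using act_K[of "inv h \<otimes> g" ?p] g h p by simp
  then have "coding.itin ?q = coding.itin ?p" using coding.K_eq_iff[OF p(2,1)] by blast
  then have "coding.itin ?q 0 = coding.itin ?p 0" by simp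
  then have "sig R (inv h \<otimes> g) = sig R \<one>" using g h by (simp add: itin_eq)
  then have "inv h \<otimes> g = \<one>" using g h by (intro sig_one[OF _ R_pos]) simp_all
  then show ?thesis using inv_solve_left[of \<one> h g] g h by simp
qed

lemma act_homeo:
  assumes g: "g \<in> carrier G"
  shows "homeomorphic_map cantor_top cantor_top (act g)"
proof -
  have cont: "continuous_map cantor_top cantor_top (act h)" if "h \<in> carrier G" for h
    by (rule continuous_map_cantor) (rule rational_fun_cont[OF rational_act[OF that]])
  have "act (inv g) (act g x) = x" "act g (act (inv g) x) = x" for x
    using act_mult[of "inv g" g] act_mult[of g "inv g"] g act_one by (simp_all add: fun_eq_iff)
  then have "homeomorphic_maps cantor_top cantor_top (act g) (act (inv g))"
    using cont[OF g] cont[OF inv_closed[OF g]] by (simp add: homeomorphic_maps_def)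
  then show ?thesis by (rule homeomorphic_maps_imp_map)
qed

lemma act_R2: "g \<in> carrier G \<Longrightarrow> act g \<in> carrier R2"
  by (simp add: R2_def rational_act act_homeo)

lemma embeds_in_R2: "\<exists>H. subgroup H R2 \<and> G \<cong> R2\<lparr>carrier := H\<rparr>"
proof -
  let ?H = "act ` carrier G"
  \<comment> \<open>The inverse in \<open>R2\<close> is a definite description, so both existence
    and uniqueness of a two-sided inverse are supplied.\<close>
  have inv_R2: "inv\<^bsub>R2\<^esub> (act g) = act (inv g)" if g: "g \<in> carrier G" for g
  proof -
    have *: "act g \<circ> act (inv g) = id" "act (inv g) \<circ> act g = id"
      using act_mult[of "inv g" g] act_mult[of g "inv g"] g act_one by simp_all
    have ex: "act (inv g) \<in> carrier R2 \<and> act g \<otimes>\<^bsub>R2\<^esub> act (inv g) = \<one>\<^bsub>R2\<^esub> \<and> act (inv g) \<otimes>\<^bsub>R2\<^esub> act g = \<one>\<^bsub>R2\<^esub>"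
      using act_R2[OF inv_closed[OF g]] * by (simp add: R2_def)
    have un: "f = act (inv g)"
      if f: "f \<in> carrier R2 \<and> act g \<otimes>\<^bsub>R2\<^esub> f = \<one>\<^bsub>R2\<^esub> \<and> f \<otimes>\<^bsub>R2\<^esub> act g = \<one>\<^bsub>R2\<^esub>" for f
    proof -
      have "act g \<circ> f = id" using f by (simp add: R2_def)
      then have "act (inv g) \<circ> (act g \<circ> f) = act (inv g)" by simp
      then show ?thesis unfolding comp_assoc[symmetric] *(2) by simp
    qed
    show ?thesis unfolding m_inv_def[of R2] using ex un by (rule the_equality)
  qed
  have sub: "subgroup ?H R2"
  proof
    show "?H \<subseteq> carrier R2" using act_R2 by auto
    show "\<one>\<^bsub>R2\<^esub> \<in> ?H" using act_one by (auto simp: R2_def intro!: image_eqI[of _ _ \<one>])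
    show "x \<otimes>\<^bsub>R2\<^esub> y \<in> ?H" if "x \<in> ?H" "y \<in> ?H" for x y
    proof -
      obtain g h where "x = act g" "y = act h" "g \<in> carrier G" "h \<in> carrier G"
        using \<open>x \<in> ?H\<close> \<open>y \<in> ?H\<close> by blast
      then show ?thesis by (intro image_eqI[of _ _ "g \<otimes> h"]) (simp_all add: R2_def act_mult)
    qed
    show "inv\<^bsub>R2\<^esub> x \<in> ?H" if "x \<in> ?H" for x
      using that inv_R2 by auto
  qed
  have "act \<in> iso G (R2\<lparr>carrier := ?H\<rparr>)"
    by (rule isoI) (auto simp: hom_def R2_def act_mult bij_betw_def intro: inj_onI act_inj)
  then have "G \<cong> R2\<lparr>carrier := ?H\<rparr>" by (rule is_isoI)
  with sub show ?thesis by blast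
qed

end

section \<open>From Gromov's inequality to the integral four-point condition\<close>

theorem theorem1:
  fixes G :: "('g, 'm) monoid_scheme"
  assumes "hyperbolic_group G"
  shows "\<exists>H. subgroup H R2 \<and> G \<cong> R2\<lparr>carrier := H\<rparr>"
proof -
  obtain S \<delta> where gr: "group G" and S: "finite S" "S \<subseteq> carrier G" "generate G S = carrier G"
    and hyp: "delta_hyperbolic_cayley G S \<delta>"
    using assms unfolding hyperbolic_group_def by blast
  interpret fg_group G S using gr S by (simp add: fg_group_def fg_group_axioms_def)
  \<comment> \<open>Gromov products carry a factor 1/2; clearing it doubles \<delta>, and rounding
    up keeps the constant integral.\<close>
  define D where "D = nat \<lceil>2 * \<delta>\<rceil>"
  have D: "2 * \<delta> \<le> real D" unfolding D_def by linarith
  have wd: "word_dist G S x y = real_of_int (d x y)" for x y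
    by (simp add: word_dist_def d_def)
  interpret hyperbolic_fg_group G S D
  proof
    fix x y z w assume c: "x \<in> carrier G" "y \<in> carrier G" "z \<in> carrier G" "w \<in> carrier G"
    then have "gromov_product G S x y w \<ge> min (gromov_product G S x z w) (gromov_product G S y z w) - \<delta>"
      using hyp unfolding delta_hyperbolic_cayley_def by blast
    then have "gromov_product G S x z w \<le> gromov_product G S x y w + \<delta>
        \<or> gromov_product G S y z w \<le> gromov_product G S x y w + \<delta>"
      by linarith
    then have "real_of_int (d x y + d w z) \<le> real_of_int (d x z + d w y + int D)
        \<or> real_of_int (d x y + d w z) \<le> real_of_int (d y z + d w x + int D)"
      using D unfolding gromov_product_def wd by (simp add: field_simps) linarith
    then have "d x y + d w z \<le> d x z + d w y + int D \<or> d x y + d w z \<le> d y z + d w x + int D"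
      unfolding of_int_le_iff .
    then have "d x y + d w z \<le> max (d x z + d w y) (d y z + d w x) + int D" by linarith
    then show "d x y + d z w \<le> max (d x z + d y w) (d y z + d x w) + int D"
      using c d_sym[of w z] d_sym[of w y] d_sym[of w x] by simp
  qed
  show ?thesis by (rule embeds_in_R2)
qed

end
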